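(* Let $\epsilon,\tau>0$ with $\epsilon+\tau\le1$, let $N$ be a positive integer, and let $T=F_T(\hat T)$ be a representative curved element of type A, B, C or D with parameters $(\epsilon,\tau,N)$. Let $\boldsymbol{u}(\boldsymbol{x})=\frac{r(|\boldsymbol{x}|)}{|\boldsymbol{x}|}\boldsymbol{x}$ be a cavity deformation and let $\Pi\boldsymbol{u}$ be its quadratic iso-parametric interpolation function on $T$. For $\boldsymbol{x}=F_T(\hat{\boldsymbol{x}})\in T$, let $(R,\theta)$ be the polar coordinates of $\boldsymbol{x}$ (so that $\boldsymbol{u}(\boldsymbol{x})$ has polar coordinates $(r(R),\theta)$) and let $(\zeta,\varphi)$ be the polar coordinates of $\Pi\boldsymbol{u}(\boldsymbol{x})$. Then $$\theta-\varphi=O(\tau^2N^{-1}+N^{-3}),$$ $$r(R)-\zeta=O(\tau^3+\epsilon\tau N^{-2}+N^{-4}),$$ where the constants in $O(\cdot)$ depend on $\|r\|_\infty$, $\|r''\|_\infty$, $\|r^{(3)}\|_\infty$, $\inf r(R)$, $\sup\frac{r'(R)}{R}$.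
   Context: Cavity deformation: $\boldsymbol{u}(\boldsymbol{x})=\frac{r(|\boldsymbol{x}|)}{|\boldsymbol{x}|}\boldsymbol{x}$ on $\mathbb{R}^2$ points with $0<|\boldsymbol{x}|\le1$, where $r$ is defined on $(0,1]$ and is smooth, positive, increasing and convex, with $r^{(j)}$ bounded for $j=0,1,2,3$, $\inf_{R\in(0,1]}r(R)>0$, and $mR\le r'(R)\le MR$ for some constants $0<m<M$. Reference element: $\hat T=\{(\hat x_1,\hat x_2):\hat x_1,\hat x_2\ge 0,\ \hat x_1+\hat x_2\le 1\}$, with barycentric coordinates $\hat\lambda_1=1-\hat x_1-\hat x_2$, $\hat\lambda_2=\hat x_1$, $\hat\lambda_3=\hat x_2$, and quadratic shape functions $\hat\mu_i=\hat\lambda_i(2\hat\lambda_i-1)$ ($1\le i\le 3$), $\hat\mu_{ij}=4\hat\lambda_i\hat\lambda_j$ ($1\le i<j\le 3$). Given points $\boldsymbol{a}_i,\boldsymbol{a}_{ij}\in\mathbb{R}^2$, the quadratic map is $F_T(\hat{\boldsymbol{x}})=\sum_{i=1}^3\boldsymbol{a}_i\hat\mu_i(\hat{\boldsymbol{x}})+\sum_{1\le i<j\le3}\boldsymbol{a}_{ij}\hat\mu_{ij}(\hat{\boldsymbol{x}})$, and $T=F_T(\hat T)$ is a curved triangular element. Interpolation: for $\boldsymbol{x}=F_T(\hat{\boldsymbol{x}})$, $\Pi\boldsymbol{u}(\boldsymbol{x})=\sum_{i=1}^3\boldsymbol{u}(\boldsymbol{a}_i)\hat\mu_i(\hat{\boldsymbol{x}})+\sum_{1\le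 i<j\le3}\boldsymbol{u}(\boldsymbol{a}_{ij})\hat\mu_{ij}(\hat{\boldsymbol{x}})$. Representative elements with parameters $(\epsilon,\tau,N)$: for $t>0$ and $\alpha\in\mathbb{R}$ write $P(t,\alpha)=t(\cos\alpha,\sin\alpha)$, and put $t_0=\epsilon$, $t_{1/2}=\epsilon+\tau/2$, $t_1=\epsilon+\tau$. Type A: $\boldsymbol{a}_1=P(t_0,0)$, $\boldsymbol{a}_2=P(t_1,-\frac{\pi}{N})$, $\boldsymbol{a}_3=P(t_1,\frac{\pi}{N})$, $\boldsymbol{a}_{12}=P(t_{1/2},-\frac{\pi}{2N})$, $\boldsymbol{a}_{13}=P(t_{1/2},\frac{\pi}{2N})$, $\boldsymbol{a}_{23}=P(t_1,0)$. Type B: $\boldsymbol{a}_1=P(t_1,0)$, $\boldsymbol{a}_2=P(t_0,\frac{\pi}{N})$, $\boldsymbol{a}_3=P(t_0,-\frac{\pi}{N})$, $\boldsymbol{a}_{12}=P(t_{1/2},\frac{\pi}{2N})$, $\boldsymbol{a}_{13}=P(t_{1/2},-\frac{\pi}{2N})$, $\boldsymbol{a}_{23}=P(t_0,0)$. Type C: $\boldsymbol{a}_1=P(t_0,0)$, $\boldsymbol{a}_2=P(t_1,0)$, $\boldsymbol{a}_3=P(t_0,\frac{\pi}{N})$, $\boldsymbol{a}_{12}=P(t_{1/2},0)$, $\boldsymbol{a}_{13}=P(t_0,\frac{\pi}{2N})$, $\boldsymbol{a}_{23}=P(t_{1/2},\frac{\pi}{2N})$. Type D: $\boldsymbol{a}_1=P(t_0,0)$,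 $\boldsymbol{a}_2=P(t_0,-\frac{\pi}{N})$, $\boldsymbol{a}_3=P(t_1,0)$, $\boldsymbol{a}_{12}=P(t_0,-\frac{\pi}{2N})$, $\boldsymbol{a}_{13}=P(t_{1/2},0)$, $\boldsymbol{a}_{23}=P(t_{1/2},-\frac{\pi}{2N})$. $O(\Psi)$ denotes a quantity bounded in absolute value by $C\Psi$, with $C$ independent of $\epsilon$, $\tau$, $N$ and $\hat{\boldsymbol{x}}$.
   Formalization: The estimate for θ−φ is stated only for τ ≤ δ, with δ>0 depending on the same five quantities of r; for large τ it fails: r=1+R²+32R⁴, ε=1/10, τ=9/10, type C, x̂=(1/4,0) gives θ=0, φ=π for every N. Also x is taken with 0<R≤1. *)

theory Defs
  imports "HOL-Analysis.Analysis"
begin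

definition polar_point :: "real \<Rightarrow> real \<Rightarrow> real^2" where
  "polar_point t \<alpha> = vector [t * cos \<alpha>, t * sin \<alpha>]"

(* Principal angle in (-pi, pi]; at the origin the radius is 0 and every such angle is admitted. *)
definition polar_coords :: "real^2 \<Rightarrow> real \<Rightarrow> real \<Rightarrow> bool" where
  "polar_coords x \<rho> \<alpha> \<longleftrightarrow> 0 \<le> \<rho> \<and> - pi < \<alpha> \<and> \<alpha> \<le> pi \<and> x = polar_point \<rho> \<alpha>"

(* The j-th derivative of a function on (0,1], one-sided at the endpoint 1.
   Only its values on (0,1] are meaningful. *)
definition rderiv :: "nat \<Rightarrow> (real \<Rightarrow> real) \<Rightarrow> real \<Rightarrow> real" where
  "rderiv j r = ((\<lambda>f R. vector_derivative f (at R within {0<..1})) ^^ j) r"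

definition cavity_profile :: "(real \<Rightarrow> real) \<Rightarrow> bool" where
  "cavity_profile r \<longleftrightarrow>
     (\<forall>j. rderiv j r differentiable_on {0<..1}) \<and>
     (\<forall>R\<in>{0<..1}. 0 < r R) \<and>
     mono_on {0<..1} r \<and>
     convex_on {0<..1} r \<and>
     (\<forall>j\<le>3. bounded (rderiv j r ` {0<..1})) \<and>
     0 < (INF R\<in>{0<..1}. r R) \<and>
     (\<exists>m M. 0 < m \<and> m < M \<and>
        (\<forall>R\<in>{0<..1}. m * R \<le> rderiv 1 r R \<and> rderiv 1 r R \<le> M * R))"

definition cavity_map :: "(real \<Rightarrow> real) \<Rightarrow> real^2 \<Rightarrow> real^2" where
  "cavity_map r x = (r (norm x) / norm x) *\<^sub>R x"

definition ref_triangle :: "(real^2) set" where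
  "ref_triangle = {x. 0 \<le> x $ 1 \<and> 0 \<le> x $ 2 \<and> x $ 1 + x $ 2 \<le> 1}"

definition bary1 :: "real^2 \<Rightarrow> real" where "bary1 x = 1 - x $ 1 - x $ 2"
definition bary2 :: "real^2 \<Rightarrow> real" where "bary2 x = x $ 1"
definition bary3 :: "real^2 \<Rightarrow> real" where "bary3 x = x $ 2"

(* Vi carries the datum a_i and Eij the datum a_ij. *)
datatype node = V1 | V2 | V3 | E12 | E13 | E23

fun shape_fun :: "node \<Rightarrow> real^2 \<Rightarrow> real" where
  "shape_fun V1 x = bary1 x * (2 * bary1 x - 1)"
| "shape_fun V2 x = bary2 x * (2 * bary2 x - 1)"
| "shape_fun V3 x = bary3 x * (2 * bary3 x - 1)"
| "shape_fun E12 x = 4 * bary1 x * bary2 x"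
| "shape_fun E13 x = 4 * bary1 x * bary3 x"
| "shape_fun E23 x = 4 * bary2 x * bary3 x"

definition quad_map :: "(node \<Rightarrow> real^2) \<Rightarrow> real^2 \<Rightarrow> real^2" where
  "quad_map a x = (\<Sum>k\<in>{V1, V2, V3, E12, E13, E23}. shape_fun k x *\<^sub>R a k)"

(* The interpolant as a function of the reference point: its value at x = quad_map a xh.
   F_T need not be injective, so it is not written as a function of x. *)
definition iso_interp :: "(real^2 \<Rightarrow> real^2) \<Rightarrow> (node \<Rightarrow> real^2) \<Rightarrow> real^2 \<Rightarrow> real^2" where
  "iso_interp u a xh = quad_map (\<lambda>k. u (a k)) xh"

datatype elem_type = TypeA | TypeB | TypeC | TypeD

fun elem_node :: "elem_type \<Rightarrow> real \<Rightarrow> real \<Rightarrow> nat \<Rightarrow> node \<Rightarrow> real^2" where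
  "elem_node TypeA \<epsilon> \<tau> N V1 = polar_point \<epsilon> 0"
| "elem_node TypeA \<epsilon> \<tau> N V2 = polar_point (\<epsilon> + \<tau>) (- (pi / real N))"
| "elem_node TypeA \<epsilon> \<tau> N V3 = polar_point (\<epsilon> + \<tau>) (pi / real N)"
| "elem_node TypeA \<epsilon> \<tau> N E12 = polar_point (\<epsilon> + \<tau> / 2) (- (pi / (2 * real N)))"
| "elem_node TypeA \<epsilon> \<tau> N E13 = polar_point (\<epsilon> + \<tau> / 2) (pi / (2 * real N))"
| "elem_node TypeA \<epsilon> \<tau> N E23 = polar_point (\<epsilon> + \<tau>) 0"
| "elem_node TypeB \<epsilon> \<tau> N V1 = polar_point (\<epsilon> + \<tau>) 0"
| "elem_node TypeB \<epsilon> \<tau> N V2 = polar_point \<epsilon> (pi / real N)"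
| "elem_node TypeB \<epsilon> \<tau> N V3 = polar_point \<epsilon> (- (pi / real N))"
| "elem_node TypeB \<epsilon> \<tau> N E12 = polar_point (\<epsilon> + \<tau> / 2) (pi / (2 * real N))"
| "elem_node TypeB \<epsilon> \<tau> N E13 = polar_point (\<epsilon> + \<tau> / 2) (- (pi / (2 * real N)))"
| "elem_node TypeB \<epsilon> \<tau> N E23 = polar_point \<epsilon> 0"
| "elem_node TypeC \<epsilon> \<tau> N V1 = polar_point \<epsilon> 0"
| "elem_node TypeC \<epsilon> \<tau> N V2 = polar_point (\<epsilon> + \<tau>) 0"
| "elem_node TypeC \<epsilon> \<tau> N V3 = polar_point \<epsilon> (pi / real N)"
| "elem_node TypeC \<epsilon> \<tau> N E12 = polar_point (\<epsilon> + \<tau> / 2) 0"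
| "elem_node TypeC \<epsilon> \<tau> N E13 = polar_point \<epsilon> (pi / (2 * real N))"
| "elem_node TypeC \<epsilon> \<tau> N E23 = polar_point (\<epsilon> + \<tau> / 2) (pi / (2 * real N))"
| "elem_node TypeD \<epsilon> \<tau> N V1 = polar_point \<epsilon> 0"
| "elem_node TypeD \<epsilon> \<tau> N V2 = polar_point \<epsilon> (- (pi / real N))"
| "elem_node TypeD \<epsilon> \<tau> N V3 = polar_point (\<epsilon> + \<tau>) 0"
| "elem_node TypeD \<epsilon> \<tau> N E12 = polar_point \<epsilon> (- (pi / (2 * real N)))"
| "elem_node TypeD \<epsilon> \<tau> N E13 = polar_point (\<epsilon> + \<tau> / 2) 0"
| "elem_node TypeD \<epsilon> \<tau> N E23 = polar_point (\<epsilon> + \<tau> / 2) (- (pi / (2 * real N)))"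

definition sup_norm :: "(real \<Rightarrow> real) \<Rightarrow> real" where
  "sup_norm f = (SUP R\<in>{0<..1}. \<bar>f R\<bar>)"

(* The quantities on which the constants in O(.) are allowed to depend. *)
definition profile_data :: "(real \<Rightarrow> real) \<Rightarrow> real \<times> real \<times> real \<times> real \<times> real" where
  "profile_data r =
     (sup_norm r, sup_norm (rderiv 2 r), sup_norm (rderiv 3 r),
      INF R\<in>{0<..1}. r R, SUP R\<in>{0<..1}. rderiv 1 r R / R)"

end

theory Submission
  imports Defs
begin

text \<open>
  In the reference triangle all four element types look alike. There are affine functions \<open>\<rho>\<close>,
  with values in \<open>[\<epsilon>, \<epsilon> + \<tau>]\<close>, and \<open>A\<close>, with \<open>\<bar>A\<bar> \<le> h\<close> for \<open>h = \<pi>/N\<close>, such that every node is the polar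
  point of radius \<open>\<rho>\<close> and angle \<open>A\<close>. Writing \<open>I\<close> for quadratic Lagrange interpolation,
  the element map is therefore \<open>(I[\<rho> cos A], I[\<rho> sin A])\<close> and the interpolated deformation is
  \<open>(I[r(\<rho>) cos A], I[r(\<rho>) sin A])\<close>. Both are compared with the polar coordinates
  \<open>(\<rho>(x), A(x))\<close> and \<open>(r(\<rho>(x)), A(x))\<close>.

  Rotating the plane by \<open>-A(x)\<close> turns a vector \<open>(I[f cos A], I[f sin A])\<close> at \<open>x\<close> into its radial component
  \<open>I[f cos D]\<close> and its tangential component \<open>I[f sin D]\<close>, where \<open>D = A - A(x)\<close> is affine, bounded by
  \<open>2h\<close> and zero at \<open>x\<close>. Interpolation is exact on products of two affine functions
  (\<open>interp_affine_mult\<close>), so the leading terms \<open>I[\<rho> D]\<close> and \<open>I[D\<^sup>2]\<close> vanish at \<open>x\<close>; and it satisfies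
  \<open>\<bar>I[g](x)\<bar> \<le> 3 p(x) B\<close> whenever \<open>\<bar>g\<bar> \<le> p B\<close> with \<open>p\<close> affine (\<open>interp_weighted_bound\<close>), which makes
  the sine and cosine remainders of the element map proportional to \<open>\<rho>(x)\<close>, however small \<open>\<epsilon>\<close> is. Taylor expansion of sine,
  cosine and \<open>r\<close> then gives, up to constants,

  \<^item> tangential components \<open>\<rho>(x) h\<^sup>3\<close> and \<open>\<tau>\<^sup>2 h + h\<^sup>3\<close>: dividing them by the radial components bounds
    \<open>\<theta> - A(x)\<close> and \<open>\<phi> - A(x)\<close>;
  \<^item> radial errors \<open>\<tau> h\<^sup>2 + \<rho>(x) h\<^sup>4\<close> and \<open>\<tau>\<^sup>3 + (\<epsilon> + \<tau>) \<tau> h\<^sup>2 + h\<^sup>4\<close>, where \<open>r'(R) \<le> M R\<close> supplies the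
    factor \<open>\<epsilon> + \<tau>\<close> and, when the first error is pushed through \<open>r\<close>, a factor of order \<open>\<rho>(x)\<close>.
    The remaining \<open>\<tau>\<^sup>2 h\<^sup>2\<close> is at most \<open>\<tau>\<^sup>3 + h\<^sup>4\<close>.

  The division needs the radial component of the interpolant to stay away from zero, which holds for
  \<open>\<tau>\<close> and \<open>h\<close> below thresholds determined by the data of \<open>r\<close>. Beyond these thresholds
  \<open>h\<^sup>3\<close>, \<open>h\<^sup>4\<close> or \<open>\<tau>\<^sup>3\<close> is bounded below and the a priori bounds
  \<open>\<bar>\<theta> - \<phi>\<bar> \<le> 2\<pi>\<close> and \<open>\<bar>r(R) - \<zeta>\<bar> \<le> 6 sup r\<close> suffice; for the angle this
  covers only coarse \<open>h\<close>, whence the threshold \<open>\<delta>\<close> on \<open>\<tau>\<close>.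
\<close>

section \<open>Quadratic interpolation on the reference triangle\<close>

fun ref_node :: "node \<Rightarrow> real^2" where
  "ref_node V1 = vector [0, 0]"
| "ref_node V2 = vector [1, 0]"
| "ref_node V3 = vector [0, 1]"
| "ref_node E12 = vector [1/2, 0]"
| "ref_node E13 = vector [0, 1/2]"
| "ref_node E23 = vector [1/2, 1/2]"

definition interp :: "(real^2 \<Rightarrow> real) \<Rightarrow> real^2 \<Rightarrow> real" where
  "interp f x = (\<Sum>k\<in>{V1, V2, V3, E12, E13, E23}. shape_fun k x * f (ref_node k))"

definition affine_fun :: "(real^2 \<Rightarrow> real) \<Rightarrow> bool" where
  "affine_fun p \<longleftrightarrow> (\<exists>a b c. \<forall>y. p y = a + b * y $ 1 + c * y $ 2)"

lemma interp_expand: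
  "interp f x = shape_fun V1 x * f (ref_node V1) + shape_fun V2 x * f (ref_node V2)
    + shape_fun V3 x * f (ref_node V3) + shape_fun E12 x * f (ref_node E12)
    + shape_fun E13 x * f (ref_node E13) + shape_fun E23 x * f (ref_node E23)"
  by (simp add: interp_def)

lemma interp_add: "interp (\<lambda>y. f y + g y) x = interp f x + interp g x"
  by (simp add: interp_expand algebra_simps)

lemma interp_diff: "interp (\<lambda>y. f y - g y) x = interp f x - interp g x"
  by (simp add: interp_expand algebra_simps)

lemma interp_cmult: "interp (\<lambda>y. c * f y) x = c * interp f x"
  by (simp add: interp_expand algebra_simps)

lemma ref_node_in: "ref_node k \<in> ref_triangle"
  by (cases k) (auto simp: ref_triangle_def)

lemma affine_funI:
  assumes "\<And>y. p y = a + b * y $ 1 + c * y $ 2" shows "affine_fun p"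
  using assms unfolding affine_fun_def by blast

lemma affine_fun_const: "affine_fun (\<lambda>y. c)"
  unfolding affine_fun_def by (rule exI[of _ c], rule exI[of _ 0], rule exI[of _ 0]) simp

lemma affine_fun_lin:
  assumes "affine_fun p" shows "affine_fun (\<lambda>y. \<alpha> + \<beta> * p y)"
proof -
  obtain a b c where "\<And>y. p y = a + b * y $ 1 + c * y $ 2"
    using assms unfolding affine_fun_def by blast
  then have "\<forall>y. \<alpha> + \<beta> * p y = (\<alpha> + \<beta> * a) + (\<beta> * b) * y $ 1 + (\<beta> * c) * y $ 2"
    by (simp add: algebra_simps)
  then show ?thesis unfolding affine_fun_def by blast
qed

lemma affine_fun_diff_const:
  assumes "affine_fun p" shows "affine_fun (\<lambda>y. p y - c)"
  using affine_fun_lin[OF assms, of "- c" 1] by simp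

text \<open>Products of two affine functions span the quadratic polynomials, which quadratic Lagrange
  interpolation reproduces.\<close>

lemma interp_affine_mult:
  assumes "affine_fun p" "affine_fun q"
  shows "interp (\<lambda>y. p y * q y) x = p x * q x"
proof -
  obtain a b c where p: "\<And>y. p y = a + b * y $ 1 + c * y $ 2"
    using assms unfolding affine_fun_def by blast
  obtain a' b' c' where q: "\<And>y. q y = a' + b' * y $ 1 + c' * y $ 2"
    using assms unfolding affine_fun_def by blast
  show ?thesis
    unfolding interp_expand p q
    by (simp add: bary1_def bary2_def bary3_def field_simps)
qed

lemma interp_affine:
  assumes "affine_fun p" shows "interp p x = p x"
  using interp_affine_mult[OF assms affine_fun_const[of 1]] by simp

text \<open>A shape function has the barycentric coordinate of each vertex that it is attached to as a factor, so a
  majorant that degenerates towards a vertex or an edge enters with its value at the evaluation point, and not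
  with its maximum. Vertex \<open>i\<close> collects the weight \<open>\<bar>2\<lambda>\<^sub>i - 1\<bar> + 2(1 - \<lambda>\<^sub>i) \<le> 3\<close> in front of
  \<open>\<lambda>\<^sub>i p\<^sub>i\<close>, which gives the constant.\<close>

lemma interp_weighted_bound:
  assumes p: "affine_fun p" and pos: "\<And>y. y \<in> ref_triangle \<Longrightarrow> 0 \<le> p y"
    and x: "x \<in> ref_triangle" and B: "0 \<le> B"
    and g: "\<And>y. y \<in> ref_triangle \<Longrightarrow> \<bar>g y\<bar> \<le> p y * B"
  shows "\<bar>interp g x\<bar> \<le> 3 * p x * B"
proof -
  obtain a b c where pe: "\<And>y. p y = a + b * y $ 1 + c * y $ 2"
    using p unfolding affine_fun_def by blast
  define l1 l2 l3 where l: "l1 = bary1 x" "l2 = bary2 x" "l3 = bary3 x"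
  define p1 p2 p3 where pv: "p1 = p (ref_node V1)" "p2 = p (ref_node V2)" "p3 = p (ref_node V3)"
  have l0: "0 \<le> l1" "0 \<le> l2" "0 \<le> l3" "l1 + l2 + l3 = 1"
    using x by (auto simp: l bary1_def bary2_def bary3_def ref_triangle_def)
  have p0: "0 \<le> p1" "0 \<le> p2" "0 \<le> p3"
    unfolding pv by (intro pos ref_node_in)+
  have px: "p x = l1 * p1 + l2 * p2 + l3 * p3"
    by (simp add: l bary1_def bary2_def bary3_def pv pe algebra_simps)
  have pm: "p (ref_node E12) = (p1 + p2) / 2" "p (ref_node E13) = (p1 + p3) / 2"
    "p (ref_node E23) = (p2 + p3) / 2"
    by (simp_all add: pv pe field_simps)
  have summand: "\<bar>w * g (ref_node k)\<bar> \<le> W * B" if "p (ref_node k) = q" "\<bar>w * q\<bar> \<le> W" for w q W k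
  proof -
    have "\<bar>w * g (ref_node k)\<bar> \<le> \<bar>w\<bar> * (q * B)"
      unfolding abs_mult using g[OF ref_node_in, of k] that(1) by (intro mult_left_mono) auto
    also have "\<dots> = \<bar>w * q\<bar> * B"
      using pos[OF ref_node_in, of k] that(1) by (simp add: abs_mult)
    also have "\<dots> \<le> W * B" using that(2) B by (intro mult_right_mono)
    finally show ?thesis .
  qed
  have vert: "\<bar>li * (2 * li - 1) * qi\<bar> \<le> li * qi * \<bar>2 * li - 1\<bar>" if "0 \<le> li" "0 \<le> qi" for li qi :: real
    using that by (simp add: abs_mult)
  have edge: "\<bar>4 * li * lj * ((qi + qj) / 2)\<bar> \<le> li * qi * (2 * lj) + lj * qj * (2 * li)"
    if "0 \<le> li" "0 \<le> lj" "0 \<le> qi" "0 \<le> qj" for li lj qi qj :: real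
    using that by (simp add: field_simps)
  have "\<bar>interp g x\<bar> \<le>
     l1 * p1 * \<bar>2 * l1 - 1\<bar> * B + l2 * p2 * \<bar>2 * l2 - 1\<bar> * B + l3 * p3 * \<bar>2 * l3 - 1\<bar> * B
     + (l1 * p1 * (2 * l2) + l2 * p2 * (2 * l1)) * B
     + (l1 * p1 * (2 * l3) + l3 * p3 * (2 * l1)) * B
     + (l2 * p2 * (2 * l3) + l3 * p3 * (2 * l2)) * B"
    unfolding interp_expand shape_fun.simps l[symmetric]
    by (intro abs_triangle_ineq[THEN order_trans] add_mono
        summand[OF pv(1)[symmetric] vert] summand[OF pv(2)[symmetric] vert]
        summand[OF pv(3)[symmetric] vert] summand[OF pm(1) edge] summand[OF pm(2) edge]
        summand[OF pm(3) edge] l0 p0)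
  also have "\<dots> = (l1 * p1 * (\<bar>2 * l1 - 1\<bar> + 2 * (l2 + l3)) + l2 * p2 * (\<bar>2 * l2 - 1\<bar> + 2 * (l1 + l3))
      + l3 * p3 * (\<bar>2 * l3 - 1\<bar> + 2 * (l1 + l2))) * B"
    by (simp add: algebra_simps)
  also have "\<dots> \<le> (l1 * p1 * 3 + l2 * p2 * 3 + l3 * p3 * 3) * B"
    using l0 p0 B by (intro mult_right_mono add_mono mult_left_mono) auto
  finally show ?thesis by (simp add: px algebra_simps)
qed

lemma interp_bound:
  assumes "x \<in> ref_triangle" "\<And>y. y \<in> ref_triangle \<Longrightarrow> \<bar>g y\<bar> \<le> B"
  shows "\<bar>interp g x\<bar> \<le> 3 * B"
proof -
  have "0 \<le> B" using assms(2)[OF assms(1)] by linarith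
  then show ?thesis
    using interp_weighted_bound[OF affine_fun_const[of 1], of x B g] assms by simp
qed

text \<open>Interpolation is linear, so it commutes with rotating the interpolated vector field.\<close>

lemma interp_rotate:
  "interp (\<lambda>y. f y * cos (A y)) x * cos \<alpha> + interp (\<lambda>y. f y * sin (A y)) x * sin \<alpha>
     = interp (\<lambda>y. f y * cos (A y - \<alpha>)) x"
  "interp (\<lambda>y. f y * sin (A y)) x * cos \<alpha> - interp (\<lambda>y. f y * cos (A y)) x * sin \<alpha>
     = interp (\<lambda>y. f y * sin (A y - \<alpha>)) x"
  unfolding interp_expand cos_diff sin_diff by (simp_all only: algebra_simps)

section \<open>Trigonometric bounds and polar coordinates\<close>

lemma sin_cubic: "\<bar>sin x - x\<bar> \<le> \<bar>x\<bar> ^ 3 / 6" for x :: real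
  using Maclaurin_sin_bound[of x 3] by (simp add: eval_nat_numeral sin_coeff_def field_simps)

lemma cos_quadratic: "\<bar>cos x - 1\<bar> \<le> x\<^sup>2 / 2" for x :: real
proof -
  have "1 - cos x = 2 * (sin (x/2))\<^sup>2" using cos_double_sin[of "x/2"] by simp
  moreover have "(sin (x/2))\<^sup>2 \<le> (x/2)\<^sup>2"
    using abs_sin_le_one abs_sin_x_le_abs_x[of "x/2"] by (metis abs_le_square_iff)
  moreover have "0 \<le> (sin (x/2))\<^sup>2" by simp
  ultimately show ?thesis by (simp add: power_divide)
qed

lemma cos_quartic: "\<bar>cos x - 1 + x\<^sup>2 / 2\<bar> \<le> x ^ 4 / 24" for x :: real
proof -
  obtain t where "cos x = (\<Sum>m<4. cos_coeff m * x ^ m) + cos (t + 1/2 * real 4 * pi) / fact 4 * x ^ 4"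
    using Maclaurin_cos_expansion[of x 4] by auto
  moreover have "(\<Sum>m<4. cos_coeff m * x ^ m) = 1 - x\<^sup>2 / 2"
  proof -
    have "{..<4} = {0, 1, 2, 3 :: nat}" by auto
    then show ?thesis by (simp add: cos_coeff_def)
  qed
  ultimately have "cos x - 1 + x\<^sup>2 / 2 = cos (t + 1/2 * real 4 * pi) * (x ^ 4 / 24)"
    by (simp add: fact_numeral)
  moreover have "\<bar>cos (t + 1/2 * real 4 * pi) * (x ^ 4 / 24)\<bar> \<le> 1 * (x ^ 4 / 24)"
    unfolding abs_mult by (intro mult_mono) auto
  ultimately show ?thesis by (simp only: mult_1)
qed

lemma arctan_le_self_nonneg:
  fixes y :: real assumes "0 \<le> y" shows "arctan y \<le> y"
proof (cases "y = 0")
  case False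
  then obtain z where "arctan y - arctan 0 = (y - 0) * inverse (1 + z\<^sup>2)"
    using MVT2[of 0 y arctan "\<lambda>z. inverse (1 + z\<^sup>2)"] assms DERIV_arctan by auto
  moreover have "inverse (1 + z\<^sup>2) \<le> 1" by (simp add: inverse_le_1_iff)
  ultimately show ?thesis using mult_left_mono[of "inverse (1 + z\<^sup>2)" 1 y] assms by simp
qed simp

lemma abs_le_abs_tan:
  fixes x :: real
  assumes "0 < cos x" "\<bar>x\<bar> < 3 * pi / 2"
  shows "\<bar>x\<bar> \<le> \<bar>tan x\<bar>"
proof -
  have "\<bar>x\<bar> < pi / 2"
  proof (rule ccontr)
    assume "\<not> \<bar>x\<bar> < pi / 2"
    then have "0 \<le> cos (pi - \<bar>x\<bar>)" using assms(2) by (intro cos_ge_zero) auto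
    then show False using assms(1) by (simp add: cos_diff)
  qed
  then have "\<bar>x\<bar> = arctan (tan \<bar>x\<bar>)" by (intro arctan_tan[symmetric]) auto
  also have "\<dots> \<le> \<bar>tan \<bar>x\<bar>\<bar>"
    using arctan_le_self_nonneg[of "tan \<bar>x\<bar>"] \<open>\<bar>x\<bar> < pi / 2\<close> tan_pos_pi2_le[of "\<bar>x\<bar>"] by simp
  also have "\<dots> = \<bar>tan x\<bar>" by (simp add: abs_if)
  finally show ?thesis .
qed

text \<open>With \<open>a\<close> and \<open>b\<close> the components of the vector after rotation by \<open>-\<beta>\<close>, the tangent of the
  angle difference is \<open>b / a\<close>. The bound on \<open>\<beta>\<close> excludes a jump of the principal angle by \<open>2\<pi>\<close>.\<close>

lemma polar_coords_offset:
  assumes p: "polar_coords v \<rho> \<alpha>" and R: "0 < \<rho>" and \<beta>: "\<bar>\<beta>\<bar> < pi / 2"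
    and a: "v $ 1 * cos \<beta> + v $ 2 * sin \<beta> = a" and b: "v $ 2 * cos \<beta> - v $ 1 * sin \<beta> = b"
    and pos: "0 < a"
  shows "\<bar>\<alpha> - \<beta>\<bar> \<le> \<bar>b\<bar> / a"
proof -
  have v: "v $ 1 = \<rho> * cos \<alpha>" "v $ 2 = \<rho> * sin \<alpha>" and al: "- pi < \<alpha>" "\<alpha> \<le> pi"
    using p by (auto simp: polar_coords_def polar_point_def)
  have c: "\<rho> * cos (\<alpha> - \<beta>) = a" and s: "\<rho> * sin (\<alpha> - \<beta>) = b"
    using a b unfolding v cos_diff sin_diff by (simp_all add: algebra_simps)
  have "0 < cos (\<alpha> - \<beta>)" using c pos R by (metis zero_less_mult_pos)
  moreover have "\<bar>\<alpha> - \<beta>\<bar> < 3 * pi / 2" using al \<beta> by linarith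
  ultimately have "\<bar>\<alpha> - \<beta>\<bar> \<le> \<bar>tan (\<alpha> - \<beta>)\<bar>" by (rule abs_le_abs_tan)
  also have "tan (\<alpha> - \<beta>) = b / a"
    using R by (simp add: tan_def c[symmetric] s[symmetric])
  finally show ?thesis using pos by simp
qed

lemma polar_coords_square:
  assumes p: "polar_coords v \<rho> \<alpha>"
    and a: "v $ 1 * cos \<beta> + v $ 2 * sin \<beta> = a" and b: "v $ 2 * cos \<beta> - v $ 1 * sin \<beta> = b"
  shows "\<rho>\<^sup>2 = a\<^sup>2 + b\<^sup>2"
proof -
  have v: "v $ 1 = \<rho> * cos \<alpha>" "v $ 2 = \<rho> * sin \<alpha>"
    using p by (auto simp: polar_coords_def polar_point_def)
  have c: "\<rho> * cos (\<alpha> - \<beta>) = a" and s: "\<rho> * sin (\<alpha> - \<beta>) = b"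
    using a b unfolding v cos_diff sin_diff by (simp_all add: algebra_simps)
  have "\<rho>\<^sup>2 * ((cos (\<alpha> - \<beta>))\<^sup>2 + (sin (\<alpha> - \<beta>))\<^sup>2) = a\<^sup>2 + b\<^sup>2"
    unfolding c[symmetric] s[symmetric] by (simp add: power_mult_distrib algebra_simps del: sin_cos_squared_add sin_cos_squared_add2)
  then show ?thesis by simp
qed

text \<open>The error is quadratic in the tangential component, as \<open>(\<rho> - a)(\<rho> + a) = b\<^sup>2\<close>; a bound
  linear in \<open>b\<close> would only give \<open>\<tau>\<^sup>2 h + h\<^sup>3\<close> for the radius.\<close>

lemma hypot_minus_leg:
  fixes a b \<rho> :: real
  assumes "\<rho>\<^sup>2 = a\<^sup>2 + b\<^sup>2" "0 \<le> \<rho>" "0 < a"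
  shows "\<bar>\<rho> - a\<bar> \<le> b\<^sup>2 / a"
proof -
  have "a \<le> \<rho>" using assms by (intro power2_le_imp_le[of a \<rho>]) auto
  moreover have "(\<rho> - a) * (\<rho> + a) = b\<^sup>2" using assms(1) by (simp add: algebra_simps power2_eq_square)
  moreover have "(\<rho> - a) * a \<le> (\<rho> - a) * (\<rho> + a)" using \<open>a \<le> \<rho>\<close> assms by (intro mult_left_mono) auto
  ultimately have "(\<rho> - a) * a \<le> b\<^sup>2" by simp
  then show ?thesis using \<open>a \<le> \<rho>\<close> assms by (simp add: field_simps)
qed

lemma hypot_le:
  fixes a b \<rho> :: real
  assumes "\<rho>\<^sup>2 = a\<^sup>2 + b\<^sup>2" 
  shows "\<rho> \<le> \<bar>a\<bar> + \<bar>b\<bar>"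
proof (rule power2_le_imp_le)
  have "(\<bar>a\<bar> + \<bar>b\<bar>)\<^sup>2 = a\<^sup>2 + b\<^sup>2 + 2 * \<bar>a\<bar> * \<bar>b\<bar>" by (simp add: power2_sum)
  then show "\<rho>\<^sup>2 \<le> (\<bar>a\<bar> + \<bar>b\<bar>)\<^sup>2" by (simp add: assms)
qed simp

lemma sum_squares_bound_twice: "(p + q)\<^sup>2 \<le> 2 * p\<^sup>2 + 2 * q\<^sup>2" for p q :: real
  using zero_le_power2[of "p - q"] by (simp add: power2_sum power2_diff)

lemma polar_point_nth [simp]:
  "polar_point t \<alpha> $ 1 = t * cos \<alpha>" "polar_point t \<alpha> $ 2 = t * sin \<alpha>"
  by (simp_all add: polar_point_def)

lemma cavity_map_polar:
  assumes "0 < t" shows "cavity_map r (polar_point t \<alpha>) = polar_point (r t) \<alpha>"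
proof -
  have "norm (polar_point t \<alpha>) = sqrt (t\<^sup>2 * ((cos \<alpha>)\<^sup>2 + (sin \<alpha>)\<^sup>2))"
    by (simp add: norm_vec_def L2_set_def sum_2 power_mult_distrib ring_distribs
        del: sin_cos_squared_add sin_cos_squared_add2)
  then have "norm (polar_point t \<alpha>) = t" using assms by simp
  then show ?thesis using assms by (simp add: cavity_map_def vec_eq_iff forall_2)
qed

section \<open>Taylor estimates for cavity profiles\<close>

text \<open>The Taylor estimates through which a cavity profile enters the argument. In \<open>taylor0\<close> the slope is bounded by
  \<open>M c\<close> because \<open>r'(t) \<le> M t \<le> M c\<close>; here \<open>r'\<close> is the first derivative and \<open>r''\<close>
  is half the second one.\<close>

locale profile =
  fixes r r' r'' :: "real \<Rightarrow> real" and S0 S2 S3 \<iota> M :: real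
  assumes low_pos: "0 < \<iota>" and slope_nonneg: "0 \<le> M"
    and range: "\<And>t. t \<in> {0<..1} \<Longrightarrow> \<iota> \<le> r t \<and> r t \<le> S0"
    and taylor0: "\<And>s t c. \<lbrakk>s \<in> {0<..1}; t \<in> {0<..1}; s \<le> c; t \<le> c\<rbrakk> \<Longrightarrow> \<bar>r s - r t\<bar> \<le> M * c * \<bar>s - t\<bar>"
    and taylor1: "\<And>s t. \<lbrakk>s \<in> {0<..1}; t \<in> {0<..1}\<rbrakk> \<Longrightarrow>
        \<bar>r s - (r t + r' t * (s - t))\<bar> \<le> S2 * \<bar>s - t\<bar> ^ 2"
    and taylor2: "\<And>s t. \<lbrakk>s \<in> {0<..1}; t \<in> {0<..1}\<rbrakk> \<Longrightarrow>
        \<bar>r s - (r t + r' t * (s - t) + r'' t * (s - t)\<^sup>2)\<bar> \<le> S3 * \<bar>s - t\<bar> ^ 3"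
begin

lemma S2_nonneg: "0 \<le> S2"
proof -
  have "0 \<le> S2 * \<bar>1 - 1/2\<bar>\<^sup>2"
    by (rule order_trans[OF abs_ge_zero taylor1]) auto
  then show ?thesis by (simp add: zero_le_mult_iff)
qed

lemma S3_nonneg: "0 \<le> S3"
proof -
  have "0 \<le> S3 * \<bar>1 - 1/2\<bar> ^ 3"
    by (rule order_trans[OF abs_ge_zero taylor2]) auto
  then show ?thesis by (simp add: zero_le_mult_iff)
qed

lemma S0_ge: "\<iota> \<le> S0" using range[of 1] by simp

end

text \<open>The constants are exactly the entries of the profile data: the Taylor remainders of order 2 and 3 are
  controlled by the suprema of the second and third derivative.\<close>

lemma cavity_profile_imp_profile:
  assumes "cavity_profile r"
  shows "profile r (rderiv 1 r) (\<lambda>t. rderiv 2 r t / 2) (sup_norm r) (sup_norm (rderiv 2 r))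
    (sup_norm (rderiv 3 r)) (INF R\<in>{0<..1}. r R) (SUP R\<in>{0<..1}. rderiv 1 r R / R)"
proof -
  let ?I = "{0<..1::real}" and ?D = "\<lambda>j. rderiv j r"
  let ?M = "SUP R\<in>{0<..1}. rderiv 1 r R / R"
  have diff: "?D j differentiable_on ?I" and pos: "\<forall>R\<in>?I. 0 < r R" 
    and iota: "0 < (INF R\<in>{0<..1}. r R)" for j
    using assms by (auto simp: cavity_profile_def)
  have bdd: "bounded (?D j ` ?I)" if "j \<le> 3" for j
    using assms that by (auto simp: cavity_profile_def)
  obtain m0 M0 where m0: "0 < m0" and dm: "\<And>R. R \<in> ?I \<Longrightarrow> m0 * R \<le> ?D 1 R \<and> ?D 1 R \<le> M0 * R"
    using assms unfolding cavity_profile_def by blast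
  have D0: "?D 0 = r" by (simp add: rderiv_def)
  \<comment> \<open>The derivatives are taken within the interval, which makes them one-sided at 1, so that the Taylor
    formula relative to a convex set applies.\<close>
  have der: "(?D j has_field_derivative ?D (Suc j) t) (at t within ?I)" if t: "t \<in> ?I" for j t
  proof -
    have "(?D j has_vector_derivative vector_derivative (?D j) (at t within ?I)) (at t within ?I)"
      using diff[of j] t by (auto simp: differentiable_on_def vector_derivative_works[symmetric])
    then show ?thesis
      by (simp add: rderiv_def has_real_derivative_iff_has_vector_derivative)
  qed
  have sup: "\<bar>?D j t\<bar> \<le> sup_norm (?D j)" if j: "j \<le> 3" and t: "t \<in> ?I" for j t
  proof -
    obtain B where "\<forall>s\<in>?I. \<bar>?D j s\<bar> \<le> B" using bdd[OF j] unfolding bounded_iff by auto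
    then have "bdd_above ((\<lambda>s. \<bar>?D j s\<bar>) ` ?I)" by (auto simp: bdd_above_def)
    then show ?thesis unfolding sup_norm_def using t by (intro cSUP_upper) auto
  qed
  have bddM: "bdd_above ((\<lambda>R. ?D 1 R / R) ` ?I)"
    by (rule bdd_aboveI2[of _ _ M0]) (use dm in \<open>auto simp: divide_le_eq\<close>)
  have slope: "0 \<le> ?D 1 t" "?D 1 t \<le> ?M * t" if t: "t \<in> ?I" for t
  proof -
    have "0 \<le> m0 * t" using m0 t by simp
    then show "0 \<le> ?D 1 t" using dm[OF t] by linarith
    have "?D 1 t / t \<le> ?M" using bddM t by (intro cSUP_upper)
    then show "?D 1 t \<le> ?M * t" using t by (simp add: divide_le_eq)
  qed
  have M: "0 \<le> ?M" using slope[of 1] by simp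
  have conv: "convex ?I" by simp
  show ?thesis
  proof
    show "0 < (INF R\<in>{0<..1}. r R)" by (rule iota)
    show "0 \<le> ?M" by (rule M)
  next
    fix t assume t: "t \<in> ?I"
    have "bdd_below (r ` ?I)" by (rule bdd_belowI2[of _ 0]) (use pos in \<open>auto intro: less_imp_le\<close>)
    then have "(INF R\<in>{0<..1}. r R) \<le> r t" using t by (intro cINF_lower)
    then show "(INF R\<in>{0<..1}. r R) \<le> r t \<and> r t \<le> sup_norm r"
      using sup[of 0 t] t by (simp add: D0)
  next
    fix s t c assume st: "s \<in> ?I" "t \<in> ?I" "s \<le> c" "t \<le> c"
    have "norm (r s - r t) \<le> (?M * c) * norm (s - t)"
    proof (rule field_differentiable_bound[of "?I \<inter> {..c}" r "?D 1"])
      show "convex (?I \<inter> {..c})" by (intro convex_Int) auto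
      fix z assume z: "z \<in> ?I \<inter> {..c}"
      show "(r has_field_derivative ?D 1 z) (at z within ?I \<inter> {..c})"
        using der[of z 0] z by (auto simp: D0 intro: DERIV_subset)
      have "?D 1 z \<le> ?M * z" using slope(2) z by blast
      also have "\<dots> \<le> ?M * c" using z M by (intro mult_left_mono) auto
      finally show "norm (?D 1 z) \<le> ?M * c" using slope(1)[of z] z by simp
    qed (use st in auto)
    then show "\<bar>r s - r t\<bar> \<le> ?M * c * \<bar>s - t\<bar>" by simp
  next
    fix s t assume st: "s \<in> ?I" "t \<in> ?I"
    have "norm (?D 0 s - (\<Sum>i\<le>1. ?D i t * (s - t) ^ i / fact i)) \<le> sup_norm (?D 2) * norm (s - t) ^ Suc 1 / fact 1"
      by (rule field_Taylor[OF conv]) (use der sup[of 2] st in \<open>auto simp: numeral_2_eq_2\<close>)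
    then show "\<bar>r s - (r t + ?D 1 t * (s - t))\<bar> \<le> sup_norm (?D 2) * \<bar>s - t\<bar>\<^sup>2"
      by (simp add: D0 numeral_2_eq_2)
    have "norm (?D 0 s - (\<Sum>i\<le>2. ?D i t * (s - t) ^ i / fact i)) \<le> sup_norm (?D 3) * norm (s - t) ^ Suc 2 / fact 2"
      by (rule field_Taylor[OF conv]) (use der sup[of 3] st in \<open>auto simp: numeral_3_eq_3 numeral_2_eq_2\<close>)
    also have "\<dots> \<le> sup_norm (?D 3) * \<bar>s - t\<bar> ^ 3"
    proof -
      have "0 \<le> sup_norm (?D 3)" using sup[of 3 1] by force
      then have "0 \<le> sup_norm (?D 3) * \<bar>s - t\<bar> ^ 3" by (intro mult_nonneg_nonneg) auto
      moreover have "sup_norm (?D 3) * norm (s - t) ^ Suc 2 / fact 2 = sup_norm (?D 3) * \<bar>s - t\<bar> ^ 3 / 2"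
        by (simp add: fact_2)
      ultimately show ?thesis by linarith
    qed
    finally have rem: "norm (?D 0 s - (\<Sum>i\<le>2. ?D i t * (s - t) ^ i / fact i)) \<le> sup_norm (?D 3) * \<bar>s - t\<bar> ^ 3" .
    show "\<bar>r s - (r t + ?D 1 t * (s - t) + ?D 2 t / 2 * (s - t)\<^sup>2)\<bar> \<le> sup_norm (?D 3) * \<bar>s - t\<bar> ^ 3"
    proof -
      have "{..2::nat} = {0, 1, 2}" by auto
      then have "(\<Sum>i\<le>2. ?D i t * (s - t) ^ i / fact i) = r t + ?D 1 t * (s - t) + ?D 2 t / 2 * (s - t)\<^sup>2"
        by (simp add: D0 fact_2)
      moreover have "norm (r s - z) = \<bar>r s - z\<bar>" for z by simp
      ultimately show ?thesis using rem by (simp only: D0)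
    qed
  qed
qed

section \<open>Affine polar coordinates on the representative elements\<close>

text \<open>Position of a reference point between the inner radius (\<open>0\<close>) and the outer radius (\<open>1\<close>) of the element.\<close>

fun depth :: "elem_type \<Rightarrow> real^2 \<Rightarrow> real" where
  "depth TypeA y = y $ 1 + y $ 2"
| "depth TypeB y = 1 - y $ 1 - y $ 2"
| "depth TypeC y = y $ 1"
| "depth TypeD y = y $ 2"

text \<open>Angular position of a reference point, in units of \<open>\<pi>/N\<close>.\<close>

fun spread :: "elem_type \<Rightarrow> real^2 \<Rightarrow> real" where
  "spread TypeA y = y $ 2 - y $ 1"
| "spread TypeB y = y $ 1 - y $ 2"
| "spread TypeC y = y $ 2"
| "spread TypeD y = - (y $ 1)"

lemma affine_depth: "affine_fun (depth ty)"
proof (cases ty)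
  case TypeA show ?thesis unfolding TypeA by (rule affine_funI[of _ 0 1 1]) simp
next
  case TypeB show ?thesis unfolding TypeB by (rule affine_funI[of _ 1 "-1" "-1"]) simp
next
  case TypeC show ?thesis unfolding TypeC by (rule affine_funI[of _ 0 1 0]) simp
next
  case TypeD show ?thesis unfolding TypeD by (rule affine_funI[of _ 0 0 1]) simp
qed

lemma affine_spread: "affine_fun (spread ty)"
proof (cases ty)
  case TypeA show ?thesis unfolding TypeA by (rule affine_funI[of _ 0 "-1" 1]) simp
next
  case TypeB show ?thesis unfolding TypeB by (rule affine_funI[of _ 0 1 "-1"]) simp
next
  case TypeC show ?thesis unfolding TypeC by (rule affine_funI[of _ 0 0 1]) simp
next
  case TypeD show ?thesis unfolding TypeD by (rule affine_funI[of _ 0 "-1" 0]) simp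
qed

lemma depth_range: "y \<in> ref_triangle \<Longrightarrow> 0 \<le> depth ty y \<and> depth ty y \<le> 1"
  by (cases ty) (auto simp: ref_triangle_def)

lemma spread_range: "y \<in> ref_triangle \<Longrightarrow> \<bar>spread ty y\<bar> \<le> 1"
  by (cases ty) (auto simp: ref_triangle_def)

text \<open>The midpoint nodes lie halfway in radius and in angle between the vertices, so one affine radius and
  one affine angle account for all six nodes of each type.\<close>

lemma elem_node_eq:
  "elem_node ty \<epsilon> \<tau> N k =
    polar_point (\<epsilon> + \<tau> * depth ty (ref_node k)) (pi / real N * spread ty (ref_node k))"
  by (cases ty; cases k) (simp_all add: field_simps)

lemma quad_map_polar_nth:
  fixes f A :: "real^2 \<Rightarrow> real"
  assumes "\<And>k. a k = polar_point (f (ref_node k)) (A (ref_node k))"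
  shows "quad_map a x $ 1 = interp (\<lambda>y. f y * cos (A y)) x"
    "quad_map a x $ 2 = interp (\<lambda>y. f y * sin (A y)) x"
  by (simp_all add: quad_map_def interp_def assms)

section \<open>Radial and tangential components on an element\<close>

text \<open>An element seen from a fixed reference point \<open>x\<close>, with its radius and angle functions; \<open>h\<close> plays the role
  of \<open>\<pi>/N\<close>.\<close>

locale polar_element =
  fixes \<rho> A :: "real^2 \<Rightarrow> real" and x :: "real^2" and \<epsilon> \<tau> h :: real
  assumes affine_rho: "affine_fun \<rho>" and affine_A: "affine_fun A"
    and x: "x \<in> ref_triangle"
    and eps: "0 < \<epsilon>" and tau: "0 < \<tau>" and le_1: "\<epsilon> + \<tau> \<le> 1"
    and rho: "\<And>y. y \<in> ref_triangle \<Longrightarrow> \<epsilon> \<le> \<rho> y \<and> \<rho> y \<le> \<epsilon> + \<tau>"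
    and A: "\<And>y. y \<in> ref_triangle \<Longrightarrow> \<bar>A y\<bar> \<le> h"
begin

definition D :: "real^2 \<Rightarrow> real" where "D y = A y - A x"

text \<open>The two components, in the frame rotated by \<open>A x\<close>, of the interpolant of the polar field with radius \<open>f\<close>
  and angle \<open>A\<close>.\<close>

definition radial :: "(real^2 \<Rightarrow> real) \<Rightarrow> real" where
  "radial f = interp (\<lambda>y. f y * cos (D y)) x"

definition tangential :: "(real^2 \<Rightarrow> real) \<Rightarrow> real" where
  "tangential f = interp (\<lambda>y. f y * sin (D y)) x"

lemma affine_D: "affine_fun D"
  unfolding D_def by (rule affine_fun_diff_const[OF affine_A])

lemma D_x: "D x = 0" by (simp add: D_def)

lemma h_nonneg: "0 \<le> h" using A[OF x] by linarith

lemma D_le: "y \<in> ref_triangle \<Longrightarrow> \<bar>D y\<bar> \<le> 2 * h"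
  using A[of y] A[OF x] by (auto simp: D_def)

lemma D_pow_le: "y \<in> ref_triangle \<Longrightarrow> \<bar>D y\<bar> ^ n \<le> (2 * h) ^ n"
  using D_le by (intro power_mono) auto

lemma rho_pos: "y \<in> ref_triangle \<Longrightarrow> 0 < \<rho> y" using rho[of y] eps by linarith

lemma rho_in: "y \<in> ref_triangle \<Longrightarrow> \<rho> y \<in> {0<..1}"
  using rho[of y] eps le_1 by auto

lemma rho_dist: "y \<in> ref_triangle \<Longrightarrow> \<bar>\<rho> y - \<rho> x\<bar> \<le> \<tau>"
  using rho[of y] rho[OF x] by auto

lemma majorised_bound:
  assumes "affine_fun p" "\<And>y. y \<in> ref_triangle \<Longrightarrow> \<bar>f y\<bar> \<le> p y"
    and "\<And>y. y \<in> ref_triangle \<Longrightarrow> \<bar>g y\<bar> \<le> B"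
  shows "\<bar>interp (\<lambda>y. f y * g y) x\<bar> \<le> 3 * p x * B"
proof (rule interp_weighted_bound[OF assms(1) _ x])
  show "0 \<le> B" using assms(3)[OF x] by linarith
  show "0 \<le> p y" if "y \<in> ref_triangle" for y using assms(2)[OF that] by linarith
  then show "\<bar>f y * g y\<bar> \<le> p y * B" if "y \<in> ref_triangle" for y
    unfolding abs_mult using assms(2,3)[OF that] that by (intro mult_mono) auto
qed

text \<open>The sine is replaced by its argument, at cubic cost; the weight \<open>p\<close> is \<open>\<rho>\<close> for the element map
  and a constant for the deformation.\<close>

lemma tangential_estimate:
  assumes "affine_fun p" "\<And>y. y \<in> ref_triangle \<Longrightarrow> \<bar>f y\<bar> \<le> p y"
  shows "\<bar>tangential f - interp (\<lambda>y. f y * D y) x\<bar> \<le> 4 * p x * h ^ 3"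
proof -
  have "tangential f - interp (\<lambda>y. f y * D y) x = interp (\<lambda>y. f y * (sin (D y) - D y)) x"
    by (simp add: tangential_def interp_diff[symmetric] right_diff_distrib)
  also have "\<bar>\<dots>\<bar> \<le> 3 * p x * ((2 * h) ^ 3 / 6)"
  proof (rule majorised_bound[OF assms])
    fix y assume "y \<in> ref_triangle"
    from D_pow_le[OF this, of 3] sin_cubic[of "D y"] show "\<bar>sin (D y) - D y\<bar> \<le> (2 * h) ^ 3 / 6" by linarith
  qed auto
  finally show ?thesis by (simp add: power_mult_distrib)
qed

lemma radial_estimate_coarse:
  assumes "affine_fun p" "\<And>y. y \<in> ref_triangle \<Longrightarrow> \<bar>f y\<bar> \<le> p y"
  shows "\<bar>radial f - interp f x\<bar> \<le> 6 * p x * h\<^sup>2"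
proof -
  have "radial f - interp f x = interp (\<lambda>y. f y * (cos (D y) - 1)) x"
    by (simp add: radial_def interp_diff[symmetric] right_diff_distrib)
  also have "\<bar>\<dots>\<bar> \<le> 3 * p x * ((2 * h) ^ 2 / 2)"
  proof (rule majorised_bound[OF assms])
    fix y assume "y \<in> ref_triangle"
    from D_pow_le[OF this, of 2] cos_quadratic[of "D y"] show "\<bar>cos (D y) - 1\<bar> \<le> (2 * h) ^ 2 / 2" by simp
  qed auto
  finally show ?thesis by (simp add: power_mult_distrib)
qed

text \<open>The second-order term of the cosine contributes \<open>I[f D\<^sup>2]\<close>. Subtracting \<open>f(x) I[D\<^sup>2] = f(x) D(x)\<^sup>2 = 0\<close>
  leaves only the oscillation of \<open>f\<close> over the element as a factor.\<close>

lemma radial_estimate_fine: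
  assumes "affine_fun p" "\<And>y. y \<in> ref_triangle \<Longrightarrow> \<bar>f y\<bar> \<le> p y"
    and B: "\<And>y. y \<in> ref_triangle \<Longrightarrow> \<bar>f y - f x\<bar> \<le> B"
  shows "\<bar>radial f - interp f x\<bar> \<le> 6 * B * h\<^sup>2 + 2 * p x * h ^ 4"
proof -
  have "interp (\<lambda>y. f x * (D y * D y)) x = 0"
    by (simp add: interp_cmult interp_affine_mult[OF affine_D affine_D] D_x)
  then have "radial f - interp f x = interp (\<lambda>y. f y * (cos (D y) - 1 + (D y)\<^sup>2 / 2)) x
      - interp (\<lambda>y. (f y - f x) * (D y)\<^sup>2) x / 2"
    unfolding radial_def interp_expand by (simp add: algebra_simps power2_eq_square add_divide_distrib diff_divide_distrib)
  moreover have "\<bar>interp (\<lambda>y. f y * (cos (D y) - 1 + (D y)\<^sup>2 / 2)) x\<bar> \<le> 3 * p x * ((2 * h) ^ 4 / 24)"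
  proof (rule majorised_bound[OF assms(1,2)])
    fix y assume "y \<in> ref_triangle"
    from D_pow_le[OF this, of 4] cos_quartic[of "D y"]
    show "\<bar>cos (D y) - 1 + (D y)\<^sup>2 / 2\<bar> \<le> (2 * h) ^ 4 / 24" by simp
  qed auto
  moreover have "\<bar>interp (\<lambda>y. (f y - f x) * (D y)\<^sup>2) x\<bar> \<le> 3 * B * (2 * h)\<^sup>2"
  proof (rule majorised_bound[OF affine_fun_const B])
    fix y assume "y \<in> ref_triangle"
    from D_pow_le[OF this, of 2] show "\<bar>(D y)\<^sup>2\<bar> \<le> (2 * h)\<^sup>2" by simp
  qed auto
  ultimately show ?thesis by (simp add: power_mult_distrib)
qed

lemma tangential_rho: "\<bar>tangential \<rho>\<bar> \<le> 4 * \<rho> x * h ^ 3"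
  using tangential_estimate[OF affine_rho, of \<rho>] rho_pos
  by (simp add: interp_affine_mult[OF affine_rho affine_D] D_x less_imp_le)

lemma radial_rho_coarse: "\<bar>radial \<rho> - \<rho> x\<bar> \<le> 6 * \<rho> x * h\<^sup>2"
  using radial_estimate_coarse[OF affine_rho, of \<rho>] rho_pos
  by (simp add: interp_affine[OF affine_rho] less_imp_le)

lemma radial_rho_fine: "\<bar>radial \<rho> - \<rho> x\<bar> \<le> 6 * \<tau> * h\<^sup>2 + 2 * \<rho> x * h ^ 4"
  using radial_estimate_fine[OF affine_rho, of \<rho> \<tau>] rho_pos rho_dist
  by (simp add: interp_affine[OF affine_rho] less_imp_le)

lemma small_h:
  assumes "24 * h\<^sup>2 \<le> 1"
  shows "h < pi / 2" "h ^ 3 \<le> h\<^sup>2 / 4" "h ^ 6 \<le> h ^ 4 / 16" "h \<le> 1/4"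
proof -
  have "h\<^sup>2 \<le> (1/4)\<^sup>2" using assms by (simp add: power2_eq_square)
  then show h: "h \<le> 1/4" by (rule power2_le_imp_le) simp
  show "h < pi / 2" using h pi_gt3 by linarith
  have "h\<^sup>2 * h \<le> h\<^sup>2 * (1/4)" using h by (intro mult_left_mono) auto
  then show "h ^ 3 \<le> h\<^sup>2 / 4" by (simp add: eval_nat_numeral)
  have "h ^ 4 * h\<^sup>2 \<le> h ^ 4 * (1/4)\<^sup>2" using \<open>h\<^sup>2 \<le> (1/4)\<^sup>2\<close> by (intro mult_left_mono) auto
  then show "h ^ 6 \<le> h ^ 4 / 16" by (simp add: eval_nat_numeral)
qed

lemma radial_rho_ge:
  assumes "24 * h\<^sup>2 \<le> 1" shows "\<rho> x / 2 \<le> radial \<rho>"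
proof -
  have "\<rho> x * (24 * h\<^sup>2) \<le> \<rho> x * 1" using assms rho_pos[OF x] by (intro mult_left_mono) auto
  then show ?thesis using radial_rho_coarse rho_pos[OF x] by linarith
qed

context
  fixes v :: "real^2" and f :: "real^2 \<Rightarrow> real"
  assumes v1: "v $ 1 = interp (\<lambda>y. f y * cos (A y)) x"
    and v2: "v $ 2 = interp (\<lambda>y. f y * sin (A y)) x"
begin

lemma rotated_components:
  "v $ 1 * cos (A x) + v $ 2 * sin (A x) = radial f"
  "v $ 2 * cos (A x) - v $ 1 * sin (A x) = tangential f"
  by (simp_all add: v1 v2 interp_rotate radial_def tangential_def D_def)

lemma angle_offset:
  assumes "polar_coords v R \<theta>" "0 < R" "h < pi / 2" "0 < radial f"
  shows "\<bar>\<theta> - A x\<bar> \<le> \<bar>tangential f\<bar> / radial f"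
  using A[OF x] assms by (intro polar_coords_offset[OF assms(1) _ _ rotated_components]) auto

lemma radius_offset:
  assumes "polar_coords v R \<theta>" "0 < radial f"
  shows "\<bar>R - radial f\<bar> \<le> (tangential f)\<^sup>2 / radial f"
  using assms by (intro hypot_minus_leg polar_coords_square[OF assms(1) rotated_components])
    (auto simp: polar_coords_def)

lemma radius_le:
  assumes "polar_coords v R \<theta>"
  shows "R \<le> \<bar>radial f\<bar> + \<bar>tangential f\<bar>"
  by (rule hypot_le) (rule polar_coords_square[OF assms(1) rotated_components])

end

text \<open>Every error of the element map carries a factor \<open>\<tau>\<close> or \<open>\<rho>(x)\<close>. The coarse bound
  \<open>R \<le> 2 \<rho>(x)\<close> makes \<open>r'\<close> of order \<open>\<rho>(x)\<close> between \<open>R\<close> and \<open>\<rho>(x)\<close>.\<close>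

lemma curved_point_radius:
  assumes v: "v $ 1 = interp (\<lambda>y. \<rho> y * cos (A y)) x" "v $ 2 = interp (\<lambda>y. \<rho> y * sin (A y)) x"
    and p: "polar_coords v R \<theta>" and h: "24 * h\<^sup>2 \<le> 1"
  shows "R \<le> 2 * \<rho> x" "\<bar>R - \<rho> x\<bar> \<le> 6 * \<tau> * h\<^sup>2 + 4 * \<rho> x * h ^ 4"
proof -
  let ?s = "\<rho> x"
  have s: "0 < ?s" by (rule rho_pos[OF x])
  have a: "?s / 2 \<le> radial \<rho>" by (rule radial_rho_ge[OF h])
  then have a0: "0 < radial \<rho>" using s by linarith
  have b: "\<bar>tangential \<rho>\<bar> \<le> 4 * ?s * h ^ 3" by (rule tangential_rho)
  have "(tangential \<rho>)\<^sup>2 \<le> (4 * ?s * h ^ 3)\<^sup>2" using b by (metis abs_ge_zero power2_abs power_mono)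
  then have "(tangential \<rho>)\<^sup>2 / radial \<rho> \<le> (4 * ?s * h ^ 3)\<^sup>2 / (?s / 2)"
    using a s by (intro frac_le) auto
  also have "\<dots> = 32 * ?s * h ^ 6"
    using s by (simp add: power2_eq_square eval_nat_numeral field_simps)
  also have "\<dots> \<le> 2 * ?s * h ^ 4"
    using mult_left_mono[OF small_h(3)[OF h], of "32 * ?s"] s by simp
  finally show "\<bar>R - ?s\<bar> \<le> 6 * \<tau> * h\<^sup>2 + 4 * ?s * h ^ 4"
    using radius_offset[OF v p a0] radial_rho_fine by linarith
  have "?s * (24 * h\<^sup>2) \<le> ?s * 1" using h s by (intro mult_left_mono) auto
  moreover have "?s * h ^ 3 \<le> ?s * (h\<^sup>2 / 4)" using small_h(2)[OF h] s by (intro mult_left_mono) auto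
  ultimately show "R \<le> 2 * ?s"
    using radius_le[OF v p] b radial_rho_coarse a0 s by linarith
qed

text \<open>Numerator and denominator are both proportional to \<open>\<rho>(x)\<close>, so the angle error does not deteriorate as
  the inner radius tends to zero.\<close>

lemma curved_point_angle:
  assumes v: "v $ 1 = interp (\<lambda>y. \<rho> y * cos (A y)) x" "v $ 2 = interp (\<lambda>y. \<rho> y * sin (A y)) x"
    and p: "polar_coords v R \<theta>" "0 < R" and h: "24 * h\<^sup>2 \<le> 1"
  shows "\<bar>\<theta> - A x\<bar> \<le> 8 * h ^ 3"
proof -
  have s: "0 < \<rho> x" by (rule rho_pos[OF x])
  have a: "\<rho> x / 2 \<le> radial \<rho>" by (rule radial_rho_ge[OF h])
  have "\<bar>\<theta> - A x\<bar> \<le> \<bar>tangential \<rho>\<bar> / radial \<rho>"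
    using a s by (intro angle_offset[OF v p small_h(1)[OF h]]) linarith
  also have "\<dots> \<le> (4 * \<rho> x * h ^ 3) / (\<rho> x / 2)"
    using tangential_rho a s by (intro frac_le) auto
  finally show ?thesis using s by simp
qed

end

section \<open>The interpolated deformation\<close>

locale deformed_element = polar_element + profile
begin

lemma profile_at: "y \<in> ref_triangle \<Longrightarrow> \<iota> \<le> r (\<rho> y) \<and> r (\<rho> y) \<le> S0"
  using range[OF rho_in] .

lemma profile_le: "y \<in> ref_triangle \<Longrightarrow> \<bar>r (\<rho> y)\<bar> \<le> S0"
  using profile_at[of y] low_pos by auto

lemma profile_dist:
  assumes y: "y \<in> ref_triangle"
  shows "\<bar>r (\<rho> y) - r (\<rho> x)\<bar> \<le> M * (\<epsilon> + \<tau>) * \<tau>"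
proof -
  have "\<bar>r (\<rho> y) - r (\<rho> x)\<bar> \<le> M * (\<epsilon> + \<tau>) * \<bar>\<rho> y - \<rho> x\<bar>"
    using rho[OF y] rho[OF x] by (intro taylor0 rho_in y x) auto
  also have "\<dots> \<le> M * (\<epsilon> + \<tau>) * \<tau>"
    using rho_dist[OF y] slope_nonneg eps tau by (intro mult_left_mono) auto
  finally show ?thesis .
qed

text \<open>The second-order Taylor polynomial of \<open>r\<close> at \<open>\<rho>(x)\<close>, composed with the affine \<open>\<rho>\<close>, is quadratic and
  thus reproduced; only the cubic remainder is left.\<close>

lemma interp_profile:
  "\<bar>interp (\<lambda>y. r (\<rho> y)) x - r (\<rho> x)\<bar> \<le> 3 * S3 * \<tau> ^ 3"
proof -
  let ?q = "\<lambda>y. \<rho> y - \<rho> x"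
  let ?P = "\<lambda>y. r (\<rho> x) + r' (\<rho> x) * ?q y + r'' (\<rho> x) * (?q y * ?q y)"
  have q: "affine_fun ?q" by (rule affine_fun_diff_const[OF affine_rho])
  have "interp ?P x = r (\<rho> x)"
    by (simp only: interp_add interp_cmult interp_affine[OF affine_fun_const] interp_affine[OF q]
        interp_affine_mult[OF q q]) simp
  then have "interp (\<lambda>y. r (\<rho> y)) x - r (\<rho> x) = interp (\<lambda>y. r (\<rho> y) - ?P y) x"
    by (simp add: interp_diff)
  also have "\<bar>\<dots>\<bar> \<le> 3 * (S3 * \<tau> ^ 3)"
  proof (rule interp_bound[OF x])
    fix y assume y: "y \<in> ref_triangle"
    have "\<bar>r (\<rho> y) - ?P y\<bar> \<le> S3 * \<bar>\<rho> y - \<rho> x\<bar> ^ 3"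
      using taylor2[OF rho_in[OF y] rho_in[OF x]] by (simp add: power2_eq_square)
    also have "\<dots> \<le> S3 * \<tau> ^ 3"
      using rho_dist[OF y] S3_nonneg by (intro mult_left_mono power_mono) auto
    finally show "\<bar>r (\<rho> y) - ?P y\<bar> \<le> S3 * \<tau> ^ 3" .
  qed
  finally show ?thesis by simp
qed

text \<open>Unlike the cubic estimate this one leads to a threshold on \<open>\<tau>\<close> in terms of \<open>M\<close> and \<open>\<iota>\<close> alone.\<close>

lemma interp_profile_coarse:
  "\<bar>interp (\<lambda>y. r (\<rho> y)) x - r (\<rho> x)\<bar> \<le> 3 * M * \<tau>"
proof -
  have "interp (\<lambda>y. r (\<rho> y)) x - r (\<rho> x) = interp (\<lambda>y. r (\<rho> y) - r (\<rho> x)) x"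
    by (simp add: interp_diff interp_affine[OF affine_fun_const])
  also have "\<bar>\<dots>\<bar> \<le> 3 * (M * \<tau>)"
  proof (rule interp_bound[OF x])
    fix y assume y: "y \<in> ref_triangle"
    have "M * (\<epsilon> + \<tau>) * \<tau> \<le> M * 1 * \<tau>"
      using slope_nonneg le_1 tau by (intro mult_right_mono mult_left_mono) auto
    then show "\<bar>r (\<rho> y) - r (\<rho> x)\<bar> \<le> M * \<tau>" using profile_dist[OF y] by simp
  qed
  finally show ?thesis by simp
qed

text \<open>The first-order Taylor polynomial of \<open>r\<close> times \<open>D\<close> is a product of affine functions and vanishes at
  \<open>x\<close>. What remains is the second-order remainder times \<open>D\<close>, hence \<open>\<tau>\<^sup>2 h\<close>.\<close>

lemma tangential_profile:
  "\<bar>tangential (\<lambda>y. r (\<rho> y))\<bar> \<le> 6 * S2 * \<tau>\<^sup>2 * h + 4 * S0 * h ^ 3"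
proof -
  let ?P = "\<lambda>y. r (\<rho> x) + r' (\<rho> x) * (\<rho> y - \<rho> x)"
  have P: "affine_fun ?P"
    by (rule affine_fun_lin[OF affine_fun_diff_const[OF affine_rho]])
  have "interp (\<lambda>y. ?P y * D y) x = 0"
    by (simp only: interp_affine_mult[OF P affine_D] D_x mult_zero_right)
  then have "interp (\<lambda>y. r (\<rho> y) * D y) x = interp (\<lambda>y. (r (\<rho> y) - ?P y) * D y) x"
    by (simp only: left_diff_distrib interp_diff diff_zero)
  also have "\<bar>\<dots>\<bar> \<le> 3 * (S2 * \<tau>\<^sup>2) * (2 * h)"
  proof (rule majorised_bound[OF affine_fun_const _ D_le])
    fix y assume y: "y \<in> ref_triangle"
    have "\<bar>r (\<rho> y) - ?P y\<bar> \<le> S2 * \<bar>\<rho> y - \<rho> x\<bar>\<^sup>2"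
      by (rule taylor1[OF rho_in[OF y] rho_in[OF x]])
    also have "\<dots> \<le> S2 * \<tau>\<^sup>2"
      using rho_dist[OF y] S2_nonneg by (intro mult_left_mono power_mono) auto
    finally show "\<bar>r (\<rho> y) - ?P y\<bar> \<le> S2 * \<tau>\<^sup>2" .
  qed
  finally show ?thesis
    using tangential_estimate[where f = "\<lambda>y. r (\<rho> y)", OF affine_fun_const profile_le] by simp
qed

lemma radial_profile:
  "\<bar>radial (\<lambda>y. r (\<rho> y)) - r (\<rho> x)\<bar>
    \<le> 3 * S3 * \<tau> ^ 3 + 6 * (M * (\<epsilon> + \<tau>) * \<tau>) * h\<^sup>2 + 2 * S0 * h ^ 4"
  using radial_estimate_fine[where f = "\<lambda>y. r (\<rho> y)", OF affine_fun_const profile_le profile_dist] interp_profile by simp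

text \<open>The two smallness conditions make the interpolation error and the cosine defect at most \<open>\<iota>/4\<close> each.\<close>

lemma radial_profile_ge:
  assumes t: "12 * (M + 1) * \<tau> \<le> \<iota>" and h: "24 * S0 * h\<^sup>2 \<le> \<iota>"
  shows "\<iota> / 2 \<le> radial (\<lambda>y. r (\<rho> y))"
proof -
  have "\<bar>radial (\<lambda>y. r (\<rho> y)) - interp (\<lambda>y. r (\<rho> y)) x\<bar> \<le> 6 * S0 * h\<^sup>2"
    by (rule radial_estimate_coarse[OF affine_fun_const profile_le])
  moreover have "12 * (M * \<tau>) \<le> \<iota>" using t tau by (simp add: algebra_simps)
  ultimately show ?thesis
    using interp_profile_coarse h profile_at[OF x] low_pos by linarith
qed

lemma small_h_if:
  assumes "24 * S0 * h\<^sup>2 \<le> \<iota>" shows "24 * h\<^sup>2 \<le> 1"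
proof -
  have "\<iota> * (24 * h\<^sup>2) \<le> S0 * (24 * h\<^sup>2)" using S0_ge by (intro mult_right_mono) auto
  then have "\<iota> * (24 * h\<^sup>2) \<le> \<iota> * 1" using assms by simp
  then show ?thesis using low_pos by simp
qed

context
  fixes v w :: "real^2" and R \<theta> \<zeta> \<phi> :: real
  assumes v: "v $ 1 = interp (\<lambda>y. \<rho> y * cos (A y)) x" "v $ 2 = interp (\<lambda>y. \<rho> y * sin (A y)) x"
    and w: "w $ 1 = interp (\<lambda>y. r (\<rho> y) * cos (A y)) x"
      "w $ 2 = interp (\<lambda>y. r (\<rho> y) * sin (A y)) x"
    and pv: "polar_coords v R \<theta>" and R: "0 < R" "R \<le> 1"
    and pw: "polar_coords w \<zeta> \<phi>"
begin

lemma angle_error: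
  assumes t: "12 * (M + 1) * \<tau> \<le> \<iota>" and h: "24 * S0 * h\<^sup>2 \<le> \<iota>"
  shows "\<bar>\<theta> - \<phi>\<bar> \<le> (8 + (12 * S2 + 8 * S0) / \<iota>) * (\<tau>\<^sup>2 * h + h ^ 3)"
proof -
  let ?a = "radial (\<lambda>y. r (\<rho> y))" and ?b = "tangential (\<lambda>y. r (\<rho> y))"
  note h' = small_h_if[OF h]
  have a: "\<iota> / 2 \<le> ?a" by (rule radial_profile_ge[OF t h])
  then have a0: "0 < ?a" using low_pos by linarith
  have "0 \<le> \<zeta>" using pw by (simp add: polar_coords_def)
  moreover have "\<zeta>\<^sup>2 = ?a\<^sup>2 + ?b\<^sup>2" by (rule polar_coords_square[OF pw rotated_components[OF w]])
  ultimately have "0 < \<zeta>" using a0 by (cases "\<zeta> = 0") (auto simp: add_nonneg_eq_0_iff)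
  then have "\<bar>\<phi> - A x\<bar> \<le> \<bar>?b\<bar> / ?a"
    using a0 by (intro angle_offset[OF w pw _ small_h(1)[OF h']])
  also have "\<dots> \<le> (6 * S2 * \<tau>\<^sup>2 * h + 4 * S0 * h ^ 3) / (\<iota> / 2)"
    using tangential_profile a low_pos S2_nonneg S0_ge h_nonneg by (intro frac_le) auto
  also have "\<dots> = 12 * S2 / \<iota> * (\<tau>\<^sup>2 * h) + 8 * S0 / \<iota> * h ^ 3"
    by (simp add: add_divide_distrib)
  also have "\<dots> \<le> 12 * S2 / \<iota> * (\<tau>\<^sup>2 * h + h ^ 3) + 8 * S0 / \<iota> * (\<tau>\<^sup>2 * h + h ^ 3)"
    using S2_nonneg S0_ge low_pos h_nonneg by (intro add_mono mult_left_mono) auto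
  also have "\<dots> = (12 * S2 + 8 * S0) / \<iota> * (\<tau>\<^sup>2 * h + h ^ 3)"
    by (simp add: add_divide_distrib algebra_simps)
  finally have phi: "\<bar>\<phi> - A x\<bar> \<le> (12 * S2 + 8 * S0) / \<iota> * (\<tau>\<^sup>2 * h + h ^ 3)" .
  have "\<bar>\<theta> - A x\<bar> \<le> 8 * h ^ 3" by (rule curved_point_angle[OF v pv R(1) h'])
  also have "\<dots> \<le> 8 * (\<tau>\<^sup>2 * h + h ^ 3)" using h_nonneg by simp
  finally show ?thesis using phi unfolding distrib_right by linarith
qed

text \<open>Three contributions: moving from \<open>\<rho>(x)\<close> to \<open>R\<close> in the argument of \<open>r\<close>, the radial error of the
  interpolant, and the square of its tangential component.\<close>

lemma radius_error:
  assumes t: "12 * (M + 1) * \<tau> \<le> \<iota>" and h: "24 * S0 * h\<^sup>2 \<le> \<iota>"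
  shows "\<bar>r R - \<zeta>\<bar> \<le> (26 * M + 3 * S3 + 2 * S0 + (144 * S2\<^sup>2 + 64 * S0\<^sup>2) / \<iota>)
      * (\<tau> ^ 3 + \<epsilon> * \<tau> * h\<^sup>2 + h ^ 4)"
proof -
  let ?a = "radial (\<lambda>y. r (\<rho> y))" and ?b = "tangential (\<lambda>y. r (\<rho> y))"
  let ?s = "\<rho> x" and ?E = "\<tau> ^ 3 + \<epsilon> * \<tau> * h\<^sup>2 + h ^ 4"
  note h' = small_h_if[OF h]
  have a: "\<iota> / 2 \<le> ?a" by (rule radial_profile_ge[OF t h])
  then have a0: "0 < ?a" using low_pos by linarith
  have s: "0 < ?s" "?s \<le> \<epsilon> + \<tau>" "?s \<le> 1" using rho_pos[OF x] rho[OF x] le_1 by auto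
  have h1: "h \<le> 1" using small_h(4)[OF h'] by simp
  have t1: "\<tau> \<le> 1" using eps le_1 by linarith
  have e0: "0 \<le> \<tau> ^ 3" "0 \<le> \<epsilon> * \<tau> * h\<^sup>2" "0 \<le> h ^ 4" using eps tau by auto
  have t4: "\<tau> ^ 4 \<le> \<tau> ^ 3" using power_decreasing[of 3 4 \<tau>] tau t1 by simp
  \<comment> \<open>The product \<open>\<tau>\<^sup>2 h\<^sup>2\<close> is absorbed by the arithmetic-geometric mean inequality.\<close>
  have "0 \<le> (\<tau>\<^sup>2 - h\<^sup>2)\<^sup>2" by simp
  then have "2 * (\<tau>\<^sup>2 * h\<^sup>2) \<le> \<tau> ^ 4 + h ^ 4" by (simp add: power2_diff flip: power_mult)
  moreover have "0 \<le> \<tau>\<^sup>2 * h\<^sup>2" by simp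
  ultimately have "\<tau>\<^sup>2 * h\<^sup>2 \<le> \<tau> ^ 3 + h ^ 4" using t4 by linarith
  then have mixed: "(\<epsilon> + \<tau>) * \<tau> * h\<^sup>2 \<le> ?E" by (simp add: algebra_simps power2_eq_square)
  have domain: "\<bar>r R - r ?s\<bar> \<le> 20 * M * ?E"
  proof -
    have "\<bar>r R - r ?s\<bar> \<le> M * (2 * ?s) * \<bar>R - ?s\<bar>"
      using R s curved_point_radius(1)[OF v pv h'] by (intro taylor0) auto
    also have "\<dots> \<le> M * (2 * ?s) * (6 * \<tau> * h\<^sup>2 + 4 * ?s * h ^ 4)"
      using curved_point_radius(2)[OF v pv h'] s slope_nonneg by (intro mult_left_mono) auto
    also have "\<dots> = M * (12 * (?s * (\<tau> * h\<^sup>2)) + 8 * (?s * ?s * h ^ 4))"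
      by (simp add: algebra_simps)
    also have "\<dots> \<le> M * (12 * ((\<epsilon> + \<tau>) * (\<tau> * h\<^sup>2)) + 8 * (1 * 1 * h ^ 4))"
      using s tau slope_nonneg by (intro mult_left_mono add_mono mult_mono) auto
    also have "\<dots> \<le> M * (20 * ?E)"
    proof (rule mult_left_mono[OF _ slope_nonneg])
      have combine: "12 * q + 8 * (1 * 1 * u) \<le> 20 * e" if "q \<le> e" "u \<le> e" for q u e :: real
        using that by linarith
      have "(\<epsilon> + \<tau>) * (\<tau> * h\<^sup>2) \<le> ?E" using mixed by (simp only: mult.assoc)
      moreover have "h ^ 4 \<le> ?E" using e0 by linarith
      ultimately show "12 * ((\<epsilon> + \<tau>) * (\<tau> * h\<^sup>2)) + 8 * (1 * 1 * h ^ 4) \<le> 20 * ?E"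
        by (rule combine)
    qed
    finally show ?thesis by (simp only: ac_simps)
  qed
  have radial: "\<bar>?a - r ?s\<bar> \<le> (6 * M + 3 * S3 + 2 * S0) * ?E"
  proof -
    have "3 * S3 * \<tau> ^ 3 \<le> 3 * S3 * ?E" using S3_nonneg e0 by (intro mult_left_mono) auto
    moreover have "2 * S0 * h ^ 4 \<le> 2 * S0 * ?E" using S0_ge low_pos e0 by (intro mult_left_mono) auto
    moreover have "6 * (M * (\<epsilon> + \<tau>) * \<tau>) * h\<^sup>2 \<le> 6 * M * ?E"
      using mult_left_mono[OF mixed, of "6 * M"] slope_nonneg by (simp add: mult.assoc)
    ultimately show ?thesis using radial_profile unfolding distrib_right by linarith
  qed
  have tangential: "?b\<^sup>2 / ?a \<le> (144 * S2\<^sup>2 + 64 * S0\<^sup>2) / \<iota> * ?E"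
  proof -
    let ?p = "6 * S2 * \<tau>\<^sup>2 * h" and ?q = "4 * S0 * h ^ 3"
    have "?b\<^sup>2 \<le> (?p + ?q)\<^sup>2"
      using tangential_profile by (metis abs_ge_zero power2_abs power_mono)
    also have "\<dots> \<le> 2 * ?p\<^sup>2 + 2 * ?q\<^sup>2" by (rule sum_squares_bound_twice)
    also have "\<dots> = 72 * S2\<^sup>2 * (\<tau> ^ 4 * h\<^sup>2) + 32 * S0\<^sup>2 * (h ^ 4 * h\<^sup>2)"
      by (simp add: power_mult_distrib flip: power_mult power_add)
    also have "\<dots> \<le> 72 * S2\<^sup>2 * (\<tau> ^ 3 * 1) + 32 * S0\<^sup>2 * (h ^ 4 * 1)"
      using t4 tau h1 h_nonneg by (intro add_mono mult_left_mono mult_mono power_le_one) auto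
    also have "\<dots> \<le> 72 * S2\<^sup>2 * ?E + 32 * S0\<^sup>2 * ?E"
      using e0 by (intro add_mono mult_left_mono) auto
    finally have sq: "?b\<^sup>2 \<le> 72 * S2\<^sup>2 * ?E + 32 * S0\<^sup>2 * ?E" .
    have "?b\<^sup>2 / ?a \<le> (72 * S2\<^sup>2 * ?E + 32 * S0\<^sup>2 * ?E) / (\<iota> / 2)"
      using a low_pos by (intro frac_le sq order_trans[OF zero_le_power2 sq]) auto
    also have "\<dots> = (144 * S2\<^sup>2 + 64 * S0\<^sup>2) / \<iota> * ?E"
      by (simp add: field_simps)
    finally show ?thesis .
  qed
  have "\<bar>\<zeta> - ?a\<bar> \<le> ?b\<^sup>2 / ?a" by (rule radius_offset[OF w pw a0])
  then have "\<bar>r R - \<zeta>\<bar> \<le> 20 * M * ?E + (6 * M + 3 * S3 + 2 * S0) * ?E + (144 * S2\<^sup>2 + 64 * S0\<^sup>2) / \<iota> * ?E"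
    using domain radial tangential by linarith
  also have "\<dots> = (26 * M + 3 * S3 + 2 * S0 + (144 * S2\<^sup>2 + 64 * S0\<^sup>2) / \<iota>) * ?E"
    by (simp add: algebra_simps)
  finally show ?thesis .
qed

lemma radius_error_trivial: "\<bar>r R - \<zeta>\<bar> \<le> 6 * S0"
proof -
  have "\<bar>radial (\<lambda>y. r (\<rho> y))\<bar> \<le> 3 * S0 * 1"
    unfolding radial_def by (rule majorised_bound[OF affine_fun_const profile_le]) auto
  moreover have "\<bar>tangential (\<lambda>y. r (\<rho> y))\<bar> \<le> 3 * S0 * 1"
    unfolding tangential_def by (rule majorised_bound[OF affine_fun_const profile_le]) auto
  moreover have "0 \<le> \<zeta>" using pw by (simp add: polar_coords_def)
  ultimately show ?thesis
    using radius_le[OF w pw] range[of R] R low_pos by (auto simp: abs_le_iff)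
qed

text \<open>When \<open>h\<close> is too large for the local analysis, this turns any constant into a multiple of \<open>h\<^sup>4\<close>.\<close>

lemma coarse_mesh:
  assumes "\<not> 24 * S0 * h\<^sup>2 \<le> \<iota>" shows "1 \<le> (24 * S0 / \<iota>)\<^sup>2 * h ^ 4"
proof -
  have "1 \<le> 24 * S0 / \<iota> * h\<^sup>2" using assms low_pos by (simp add: field_simps)
  then have "1 \<le> (24 * S0 / \<iota> * h\<^sup>2)\<^sup>2" by (rule one_le_power)
  also have "\<dots> = (24 * S0 / \<iota>)\<^sup>2 * h ^ 4"
    by (simp only: power_mult_distrib power_mult[symmetric]) simp
  finally show ?thesis .
qed

lemma angle_bound:
  assumes t: "12 * (M + 1) * \<tau> \<le> \<iota>" and h: "h \<le> pi"
  shows "\<bar>\<theta> - \<phi>\<bar> \<le> (8 + (12 * S2 + 8 * S0) / \<iota> + 2 * pi\<^sup>2 * (24 * S0 / \<iota>)\<^sup>2) * (\<tau>\<^sup>2 * h + h ^ 3)"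
proof (cases "24 * S0 * h\<^sup>2 \<le> \<iota>")
  case True
  show ?thesis
    using h_nonneg by (intro order_trans[OF angle_error[OF t True]] mult_right_mono) auto
next
  case False
  let ?K = "24 * S0 / \<iota>" and ?E = "\<tau>\<^sup>2 * h + h ^ 3"
  have "\<bar>\<theta> - \<phi>\<bar> \<le> 2 * pi * 1" using pv pw by (auto simp: polar_coords_def)
  also have "\<dots> \<le> 2 * pi * (?K\<^sup>2 * h ^ 4)" using coarse_mesh[OF False] by (intro mult_left_mono) auto
  also have "\<dots> = 2 * pi * (?K\<^sup>2 * h ^ 3) * h" by (simp add: eval_nat_numeral)
  also have "\<dots> \<le> 2 * pi * (?K\<^sup>2 * h ^ 3) * pi" using h h_nonneg by (intro mult_left_mono) auto
  also have "\<dots> = 2 * pi\<^sup>2 * ?K\<^sup>2 * h ^ 3" by (simp add: power2_eq_square)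
  also have "\<dots> \<le> (8 + (12 * S2 + 8 * S0) / \<iota> + 2 * pi\<^sup>2 * ?K\<^sup>2) * ?E"
    using S2_nonneg S0_ge low_pos h_nonneg by (intro mult_mono) auto
  finally show ?thesis .
qed

text \<open>Both smallness conditions are removed by letting the constant absorb the bound \<open>6 S0\<close> when one of
  them fails.\<close>

lemma radius_bound:
  "\<bar>r R - \<zeta>\<bar> \<le> (26 * M + 3 * S3 + 2 * S0 + (144 * S2\<^sup>2 + 64 * S0\<^sup>2) / \<iota>
      + 6 * S0 * (24 * S0 / \<iota>)\<^sup>2 + 6 * S0 * (12 * (M + 1) / \<iota>) ^ 3)
      * (\<tau> ^ 3 + \<epsilon> * \<tau> * h\<^sup>2 + h ^ 4)"
    (is "_ \<le> (?c + ?c1 + ?c2) * ?E")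
proof -
  have E: "h ^ 4 \<le> ?E" "\<tau> ^ 3 \<le> ?E" "0 \<le> ?E" using eps tau h_nonneg by auto
  have c: "0 \<le> ?c" "0 \<le> ?c1" "0 \<le> ?c2"
    using slope_nonneg S0_ge low_pos S3_nonneg by auto
  consider "12 * (M + 1) * \<tau> \<le> \<iota>" "24 * S0 * h\<^sup>2 \<le> \<iota>" | "\<not> 24 * S0 * h\<^sup>2 \<le> \<iota>"
    | "\<not> 12 * (M + 1) * \<tau> \<le> \<iota>" by blast
  then have "\<bar>r R - \<zeta>\<bar> \<le> ?c * ?E \<or> \<bar>r R - \<zeta>\<bar> \<le> ?c1 * ?E \<or> \<bar>r R - \<zeta>\<bar> \<le> ?c2 * ?E"
  proof cases
    case 1 then show ?thesis using radius_error by blast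
  next
    case 2
    have "6 * S0 * 1 \<le> 6 * S0 * ((24 * S0 / \<iota>)\<^sup>2 * h ^ 4)"
      using coarse_mesh[OF 2] S0_ge low_pos by (intro mult_left_mono) auto
    also have "\<dots> = ?c1 * h ^ 4" by simp
    also have "\<dots> \<le> ?c1 * ?E" using E c by (intro mult_left_mono)
    finally show ?thesis using radius_error_trivial by linarith
  next
    case 3
    then have "1 \<le> (12 * (M + 1) / \<iota> * \<tau>) ^ 3"
      using low_pos by (intro one_le_power) (simp add: field_simps)
    then have "6 * S0 * 1 \<le> 6 * S0 * (12 * (M + 1) / \<iota> * \<tau>) ^ 3"
      using S0_ge low_pos by (intro mult_left_mono) auto
    also have "\<dots> = ?c2 * \<tau> ^ 3" by (simp only: power_mult_distrib mult.assoc)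
    also have "\<dots> \<le> ?c2 * ?E" using E c by (intro mult_left_mono)
    finally show ?thesis using radius_error_trivial by linarith
  qed
  moreover note mult_nonneg_nonneg[OF c(1) E(3)] mult_nonneg_nonneg[OF c(2) E(3)] mult_nonneg_nonneg[OF c(3) E(3)]
  ultimately show ?thesis unfolding distrib_right by linarith
qed

end

end

section \<open>The interpolation error of the cavity deformation\<close>

text \<open>The summand \<open>0\<close> in the angle function gives it the shape of the rule for affine functions.\<close>

lemma deformed_element_elem_node:
  assumes "cavity_profile r" "0 < \<epsilon>" "0 < \<tau>" "\<epsilon> + \<tau> \<le> 1" "1 \<le> N" "xh \<in> ref_triangle"
    and "profile_data r = (S0, S2, S3, \<iota>, M)"
  shows "deformed_element (\<lambda>y. \<epsilon> + \<tau> * depth ty y) (\<lambda>y. 0 + pi / real N * spread ty y) xh \<epsilon> \<tau> (pi / real N)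
    r (rderiv 1 r) (\<lambda>t. rderiv 2 r t / 2) S0 S2 S3 \<iota> M"
proof -
  interpret profile r "rderiv 1 r" "\<lambda>t. rderiv 2 r t / 2" S0 S2 S3 \<iota> M
    using cavity_profile_imp_profile[OF assms(1)] assms(7) by (simp add: profile_data_def)
  show ?thesis
  proof
    fix y assume y: "y \<in> ref_triangle"
    show "\<epsilon> \<le> \<epsilon> + \<tau> * depth ty y \<and> \<epsilon> + \<tau> * depth ty y \<le> \<epsilon> + \<tau>"
      using depth_range[OF y, of ty] assms(3) by (simp add: mult_left_le)
    have "pi / real N * \<bar>spread ty y\<bar> \<le> pi / real N * 1"
      using spread_range[OF y] by (intro mult_left_mono) auto
    then show "\<bar>0 + pi / real N * spread ty y\<bar> \<le> pi / real N"
      by (simp add: abs_mult)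
  next
    show "affine_fun (\<lambda>y. \<epsilon> + \<tau> * depth ty y)" by (rule affine_fun_lin[OF affine_depth])
    show "affine_fun (\<lambda>y. 0 + pi / real N * spread ty y)" by (rule affine_fun_lin[OF affine_spread])
  qed (use assms in auto)
qed

theorem theorem3p2:
  shows "\<exists>C\<^sub>1 C\<^sub>2 \<delta> :: real \<times> real \<times> real \<times> real \<times> real \<Rightarrow> real.
    (\<forall>d. 0 < \<delta> d) \<and>
    (\<forall>r. cavity_profile r \<longrightarrow>
      (\<forall>(ty :: elem_type) (\<epsilon> :: real) (\<tau> :: real) (N :: nat) (xh :: real^2)
        (R :: real) (\<theta> :: real) (\<zeta> :: real) (\<phi> :: real).
        0 < \<epsilon> \<and> 0 < \<tau> \<and> \<epsilon> + \<tau> \<le> 1 \<and> 1 \<le> N \<and> xh \<in> ref_triangle \<and>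
        0 < R \<and> R \<le> 1 \<and>
        polar_coords (quad_map (elem_node ty \<epsilon> \<tau> N) xh) R \<theta> \<and>
        polar_coords (iso_interp (cavity_map r) (elem_node ty \<epsilon> \<tau> N) xh) \<zeta> \<phi> \<longrightarrow>
        polar_coords (cavity_map r (quad_map (elem_node ty \<epsilon> \<tau> N) xh)) (r R) \<theta> \<and>
        (\<tau> \<le> \<delta> (profile_data r) \<longrightarrow>
          \<bar>\<theta> - \<phi>\<bar> \<le> C\<^sub>1 (profile_data r) * (\<tau>^2 / real N + 1 / real N ^ 3)) \<and>
        \<bar>r R - \<zeta>\<bar> \<le> C\<^sub>2 (profile_data r) * (\<tau>^3 + \<epsilon> * \<tau> / real N ^ 2 + 1 / real N ^ 4)))"
proof -
  define C1 where "C1 = (\<lambda>(S0, S2, S3 :: real, \<iota>, M :: real).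
    (8 + (12 * S2 + 8 * S0) / \<iota> + 2 * pi\<^sup>2 * (24 * S0 / \<iota>)\<^sup>2) * pi ^ 3)"
  define C2 where "C2 = (\<lambda>(S0, S2, S3, \<iota>, M).
    (26 * M + 3 * S3 + 2 * S0 + (144 * S2\<^sup>2 + 64 * S0\<^sup>2) / \<iota>
      + 6 * S0 * (24 * S0 / \<iota>)\<^sup>2 + 6 * S0 * (12 * (M + 1) / \<iota>) ^ 3) * pi ^ 4)"
  \<comment> \<open>The value 1 is only there to make \<open>\<delta>\<close> positive on tuples that are not the data of a profile.\<close>
  define \<delta> where "\<delta> = (\<lambda>(S0 :: real, S2 :: real, S3 :: real, \<iota>, M :: real).
    if 0 < \<iota> / (12 * (M + 1)) then \<iota> / (12 * (M + 1)) else 1)"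
  have "0 < \<delta> d" for d by (cases d) (simp add: \<delta>_def)
  moreover have "polar_coords (cavity_map r (quad_map (elem_node ty \<epsilon> \<tau> N) xh)) (r R) \<theta> \<and>
      (\<tau> \<le> \<delta> (profile_data r) \<longrightarrow> \<bar>\<theta> - \<phi>\<bar> \<le> C1 (profile_data r) * (\<tau>^2 / real N + 1 / real N ^ 3)) \<and>
      \<bar>r R - \<zeta>\<bar> \<le> C2 (profile_data r) * (\<tau>^3 + \<epsilon> * \<tau> / real N ^ 2 + 1 / real N ^ 4)"
    if r: "cavity_profile r" and hyps: "0 < \<epsilon>" "0 < \<tau>" "\<epsilon> + \<tau> \<le> 1" "1 \<le> N" "xh \<in> ref_triangle"
      and R: "0 < R" "R \<le> 1"
      and pv: "polar_coords (quad_map (elem_node ty \<epsilon> \<tau> N) xh) R \<theta>"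
      and pw: "polar_coords (iso_interp (cavity_map r) (elem_node ty \<epsilon> \<tau> N) xh) \<zeta> \<phi>"
    for r ty \<epsilon> \<tau> N xh R \<theta> \<zeta> \<phi>
  proof -
    obtain S0 S2 S3 \<iota> M where d: "profile_data r = (S0, S2, S3, \<iota>, M)" by (metis prod_cases5)
    define \<rho> where "\<rho> y = \<epsilon> + \<tau> * depth ty y" for y
    define A where "A y = 0 + pi / real N * spread ty y" for y
    interpret deformed_element \<rho> A xh \<epsilon> \<tau> "pi / real N" r "rderiv 1 r" "\<lambda>t. rderiv 2 r t / 2" S0 S2 S3 \<iota> M
      unfolding \<rho>_def[abs_def] A_def[abs_def] by (rule deformed_element_elem_node[OF r hyps d])
    have nodes: "elem_node ty \<epsilon> \<tau> N k = polar_point (\<rho> (ref_node k)) (A (ref_node k))" for k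
      by (simp add: elem_node_eq \<rho>_def A_def)
    have images: "cavity_map r (elem_node ty \<epsilon> \<tau> N k) = polar_point (r (\<rho> (ref_node k))) (A (ref_node k))" for k
      unfolding nodes by (rule cavity_map_polar[OF rho_pos[OF ref_node_in]])
    note v = quad_map_polar_nth[where f = \<rho> and A = A, OF nodes]
    note w = quad_map_polar_nth[where f = "\<lambda>y. r (\<rho> y)" and A = A, OF images, folded iso_interp_def]
    have rR: "0 < r R" using range[of R] R low_pos by auto
    have "polar_coords (cavity_map r (quad_map (elem_node ty \<epsilon> \<tau> N) xh)) (r R) \<theta>"
      using pv rR R cavity_map_polar[of R r \<theta>] by (auto simp: polar_coords_def)
    moreover have "\<bar>\<theta> - \<phi>\<bar> \<le> C1 (profile_data r) * (\<tau>^2 / real N + 1 / real N ^ 3)"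
      if "\<tau> \<le> \<delta> (profile_data r)"
    proof -
      have "\<tau> \<le> \<iota> / (12 * (M + 1))"
        using that slope_nonneg low_pos by (simp add: d \<delta>_def)
      then have t: "12 * (M + 1) * \<tau> \<le> \<iota>" using slope_nonneg by (simp add: field_simps)
      have N: "pi / real N \<le> pi" using hyps(4) by (simp add: divide_le_eq)
      have pi: "pi \<le> pi ^ 3" using pi_gt3 by (intro self_le_power) auto
      have "\<tau>\<^sup>2 * (pi / real N) + (pi / real N) ^ 3 \<le> pi ^ 3 * (\<tau>\<^sup>2 / real N + 1 / real N ^ 3)"
        using mult_right_mono[OF pi, of "\<tau>\<^sup>2 / real N"] by (simp add: power_divide distrib_left mult.commute)
      then have "(8 + (12 * S2 + 8 * S0) / \<iota> + 2 * pi\<^sup>2 * (24 * S0 / \<iota>)\<^sup>2)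
            * (\<tau>\<^sup>2 * (pi / real N) + (pi / real N) ^ 3)
          \<le> (8 + (12 * S2 + 8 * S0) / \<iota> + 2 * pi\<^sup>2 * (24 * S0 / \<iota>)\<^sup>2)
            * (pi ^ 3 * (\<tau>\<^sup>2 / real N + 1 / real N ^ 3))"
        using S2_nonneg S0_ge low_pos by (intro mult_left_mono) auto
      with angle_bound[OF v w pv R pw t N] show ?thesis
        unfolding d C1_def by (simp only: prod.case mult.assoc)
    qed
    moreover have "\<bar>r R - \<zeta>\<bar> \<le> C2 (profile_data r) * (\<tau>^3 + \<epsilon> * \<tau> / real N ^ 2 + 1 / real N ^ 4)"
    proof -
      have pi: "pi\<^sup>2 \<le> pi ^ 4" "1 \<le> pi ^ 4" using pi_gt3 by (auto intro: power_increasing one_le_power)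
      have "\<tau> ^ 3 + \<epsilon> * \<tau> * (pi / real N)\<^sup>2 + (pi / real N) ^ 4
          \<le> pi ^ 4 * (\<tau>^3 + \<epsilon> * \<tau> / real N ^ 2 + 1 / real N ^ 4)"
        using mult_right_mono[OF pi(1), of "\<epsilon> * \<tau> / real N ^ 2"] mult_right_mono[OF pi(2), of "\<tau> ^ 3"] hyps(1,2)
        by (auto simp: power_divide distrib_left mult.commute intro!: add_mono)
      then have "(26 * M + 3 * S3 + 2 * S0 + (144 * S2\<^sup>2 + 64 * S0\<^sup>2) / \<iota>
          + 6 * S0 * (24 * S0 / \<iota>)\<^sup>2 + 6 * S0 * (12 * (M + 1) / \<iota>) ^ 3)
          * (\<tau> ^ 3 + \<epsilon> * \<tau> * (pi / real N)\<^sup>2 + (pi / real N) ^ 4)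
        \<le> (26 * M + 3 * S3 + 2 * S0 + (144 * S2\<^sup>2 + 64 * S0\<^sup>2) / \<iota>
          + 6 * S0 * (24 * S0 / \<iota>)\<^sup>2 + 6 * S0 * (12 * (M + 1) / \<iota>) ^ 3)
          * (pi ^ 4 * (\<tau>^3 + \<epsilon> * \<tau> / real N ^ 2 + 1 / real N ^ 4))"
        using S3_nonneg S0_ge low_pos slope_nonneg by (intro mult_left_mono) auto
      with radius_bound[OF v w pv R pw] show ?thesis
        unfolding d C2_def by (simp only: prod.case mult.assoc)
    qed
    ultimately show ?thesis by blast
  qed
  ultimately show ?thesis
    by (intro exI[of _ C1] exI[of _ C2] exI[of _ \<delta>]) blast
qed

end
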